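(* Let $\Bbbk$ be an algebraically closed field and $\mathscr{C}$ a locally-finite, pivotal, abelian, tensor $\Bbbk$-category with enough projectives. Let $P$ be the injective hull of the unit object $\mathbf 1$ and let $\beta$ be the simple head of $P$. Then the full subcategory $\mathcal{P}roj(\mathscr{C})$ of projective objects is an $(\operatorname{Id},F_\beta)$-twisted Calabi-Yau category, where $F_\beta=\beta\otimes -$; hence $F_\beta$ is a right Serre functor on $\mathcal{P}roj(\mathscr{C})$.
   Context: Composition of morphisms is written $fg=f\circ g$. A pivotal tensor $\Bbbk$-category is a strict monoidal category $\mathscr{C}$ that is additive, with hom-sets $\Bbbk$-modules and with $\Bbbk$-bilinear composition and tensor product, such that $\Bbbk\to\operatorname{End}_{\mathscr{C}}(\mathbf{1})$, $k\mapsto k\operatorname{Id}_{\mathbf 1}$, is an isomorphism, and such that each object $V$ has a left and right dual $V^*$ with evaluation and coevaluation morphisms satisfying the zig-zag identities, for which the left and right duals of each morphism coincide and the two canonical isomorphisms $W^*\otimes V^*\to (V\otimes W)^*$ coincide. Locally-finite: every $\operatorname{Hom}_{\mathscr{C}}(X,Y)$ has finite length over $\Bbbk$ and every object has finite length. Enough projectives: every object has a projective cover. In such a category projective and injective objects coincide. The head of an indecomposable projective object is its unique simple quotient. Twisted Calabi-Yau category: for endofunctors $F,G$ of a $\Bbbk$-linear category $\mathscr{D}$, $\mathscr{D}$ is $(F,G)$-twisted Calabi-Yau if it is equipped with $\Bbbk$-linear maps $\mathsf{t}_U:\operatorname{Hom}_{\mathscr{D}}(F(U),G(U))\to\Bbbk$,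 $U\in\mathscr{D}$, such that (1) for all $U,V\in\mathscr{D}$ the pairing $\operatorname{Hom}_{\mathscr{D}}(V,G(U))\times\operatorname{Hom}_{\mathscr{D}}(F(U),V)\to\Bbbk$, $(g,f)\mapsto\mathsf{t}_U(gf)$, is non-degenerate; (2) $\mathsf{t}_V(G(g)f)=\mathsf{t}_U(fF(g))$ for all $U,V\in\mathscr{D}$, $f:F(V)\to G(U)$, $g:U\to V$. Right Serre functor (in the sense of Bondal-Kapranov): an endofunctor $G$ of $\mathscr{D}$ together with vector space isomorphisms $\operatorname{Hom}_{\mathscr{D}}(U,V)\cong\operatorname{Hom}_{\mathscr{D}}(V,G(U))^*$ functorial in both $U$ and $V$. *)

theory Defs
  imports "HOL-Algebra.Algebra"
begin

no_notation Polynomials.var (\<open>X\<index>\<close>)  (* frees X for objects *)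

section \<open>Linear algebra over a commutative ring\<close>

definition linear_map ::
    "('k, 'r) ring_scheme \<Rightarrow> ('k, 'a, 'c) module_scheme \<Rightarrow> ('k, 'b, 'd) module_scheme \<Rightarrow> ('a \<Rightarrow> 'b) \<Rightarrow> bool"
  where "linear_map K M N h \<longleftrightarrow>
    h \<in> carrier M \<rightarrow> carrier N \<and>
    (\<forall>x\<in>carrier M. \<forall>y\<in>carrier M. h (x \<oplus>\<^bsub>M\<^esub> y) = h x \<oplus>\<^bsub>N\<^esub> h y) \<and>
    (\<forall>a\<in>carrier K. \<forall>x\<in>carrier M. h (a \<odot>\<^bsub>M\<^esub> x) = a \<odot>\<^bsub>N\<^esub> h x)"

definition linear_iso ::
    "('k, 'r) ring_scheme \<Rightarrow> ('k, 'a, 'c) module_scheme \<Rightarrow> ('k, 'b, 'd) module_scheme \<Rightarrow> ('a \<Rightarrow> 'b) \<Rightarrow> bool"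
  where "linear_iso K M N h \<longleftrightarrow> linear_map K M N h \<and> bij_betw h (carrier M) (carrier N)"

definition linear_form :: "('k, 'r) ring_scheme \<Rightarrow> ('k, 'a, 'c) module_scheme \<Rightarrow> ('a \<Rightarrow> 'k) \<Rightarrow> bool"
  where "linear_form K M \<phi> \<longleftrightarrow>
    \<phi> \<in> carrier M \<rightarrow> carrier K \<and>
    (\<forall>x\<in>carrier M. \<forall>y\<in>carrier M. \<phi> (x \<oplus>\<^bsub>M\<^esub> y) = \<phi> x \<oplus>\<^bsub>K\<^esub> \<phi> y) \<and>
    (\<forall>a\<in>carrier K. \<forall>x\<in>carrier M. \<phi> (a \<odot>\<^bsub>M\<^esub> x) = a \<otimes>\<^bsub>K\<^esub> \<phi> x)"

text \<open>The dual module consists of linear forms that are extensional (undefined off the carrier),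
  so that equality of forms is equality of functions. The record type of modules extends that of
  rings; its multiplicative fields carry no meaning for a module and are left undefined.\<close>

definition dual_module :: "('k, 'r) ring_scheme \<Rightarrow> ('k, 'a, 'c) module_scheme \<Rightarrow> ('k, 'a \<Rightarrow> 'k) module"
  where "dual_module K M =
    \<lparr> carrier = {\<phi> \<in> extensional (carrier M). linear_form K M \<phi>},
      monoid.mult = undefined, monoid.one = undefined,
      ring.zero = (\<lambda>x\<in>carrier M. \<zero>\<^bsub>K\<^esub>),
      ring.add = (\<lambda>\<phi> \<psi>. \<lambda>x\<in>carrier M. \<phi> x \<oplus>\<^bsub>K\<^esub> \<psi> x),
      smult = (\<lambda>a \<phi>. \<lambda>x\<in>carrier M. a \<otimes>\<^bsub>K\<^esub> \<phi> x) \<rparr>"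

definition nondegenerate ::
    "('k, 'r) ring_scheme \<Rightarrow> ('k, 'a, 'c) module_scheme \<Rightarrow> ('k, 'b, 'd) module_scheme \<Rightarrow> ('a \<Rightarrow> 'b \<Rightarrow> 'k) \<Rightarrow> bool"
  where "nondegenerate K M N B \<longleftrightarrow>
    (\<forall>x\<in>carrier M. (\<forall>y\<in>carrier N. B x y = \<zero>\<^bsub>K\<^esub>) \<longrightarrow> x = \<zero>\<^bsub>M\<^esub>) \<and>
    (\<forall>y\<in>carrier N. (\<forall>x\<in>carrier M. B x y = \<zero>\<^bsub>K\<^esub>) \<longrightarrow> y = \<zero>\<^bsub>N\<^esub>)"

text \<open>Existence of a composition series.\<close>

definition finite_length_module :: "('k, 'r) ring_scheme \<Rightarrow> ('k, 'a, 'c) module_scheme \<Rightarrow> bool"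
  where "finite_length_module K M \<longleftrightarrow>
    (\<exists>n N. N 0 = {\<zero>\<^bsub>M\<^esub>} \<and> N n = carrier M \<and>
      (\<forall>i\<le>n. submodule (N i) K M) \<and>
      (\<forall>i<n. N i \<subset> N (Suc i) \<and>
        \<not> (\<exists>L. submodule L K M \<and> N i \<subset> L \<and> L \<subset> N (Suc i))))"


section \<open>Linear categories\<close>

record ('k, 'o, 'm) linear_cat =
  Obj :: "'o set"
  Hom :: "'o \<Rightarrow> 'o \<Rightarrow> ('k, 'm) module"
  Ident :: "'o \<Rightarrow> 'm"
  Comp :: "'m \<Rightarrow> 'm \<Rightarrow> 'm"  (infixl \<open>\<cdot>\<index>\<close> 70)

abbreviation Mor :: "('k, 'o, 'm, 'z) linear_cat_scheme \<Rightarrow> 'o \<Rightarrow> 'o \<Rightarrow> 'm set"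
  where "Mor C X Y \<equiv> carrier (Hom C X Y)"

locale linear_category =
  fixes K :: "('k, 'r) ring_scheme" and C :: "('k, 'o, 'm, 'z) linear_cat_scheme" (structure)
  assumes hom_module: "\<lbrakk>X \<in> Obj C; Y \<in> Obj C\<rbrakk> \<Longrightarrow> module K (Hom C X Y)"
    and hom_disjoint: "\<lbrakk>X \<in> Obj C; Y \<in> Obj C; X' \<in> Obj C; Y' \<in> Obj C;
      f \<in> Mor C X Y; f \<in> Mor C X' Y'\<rbrakk> \<Longrightarrow> X = X' \<and> Y = Y'"
    and ident_in_hom: "X \<in> Obj C \<Longrightarrow> Ident C X \<in> Mor C X X"
    and comp_in_hom: "\<lbrakk>X \<in> Obj C; Y \<in> Obj C; Z \<in> Obj C; g \<in> Mor C Y Z; f \<in> Mor C X Y\<rbrakk>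
      \<Longrightarrow> g \<cdot> f \<in> Mor C X Z"
    and comp_ident: "\<lbrakk>X \<in> Obj C; Y \<in> Obj C; f \<in> Mor C X Y\<rbrakk>
      \<Longrightarrow> f \<cdot> Ident C X = f \<and> Ident C Y \<cdot> f = f"
    and comp_assoc: "\<lbrakk>W \<in> Obj C; X \<in> Obj C; Y \<in> Obj C; Z \<in> Obj C;
      h \<in> Mor C Y Z; g \<in> Mor C X Y; f \<in> Mor C W X\<rbrakk> \<Longrightarrow> (h \<cdot> g) \<cdot> f = h \<cdot> (g \<cdot> f)"
    and comp_linear_left: "\<lbrakk>X \<in> Obj C; Y \<in> Obj C; Z \<in> Obj C; f \<in> Mor C X Y\<rbrakk>
      \<Longrightarrow> linear_map K (Hom C Y Z) (Hom C X Z) (\<lambda>g. g \<cdot> f)"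
    and comp_linear_right: "\<lbrakk>X \<in> Obj C; Y \<in> Obj C; Z \<in> Obj C; g \<in> Mor C Y Z\<rbrakk>
      \<Longrightarrow> linear_map K (Hom C X Y) (Hom C X Z) (\<lambda>f. g \<cdot> f)"

definition full_subcategory ::
    "('k, 'o, 'm, 'z) linear_cat_scheme \<Rightarrow> 'o set \<Rightarrow> ('k, 'o, 'm) linear_cat"
  where "full_subcategory C S = \<lparr> Obj = S, Hom = Hom C, Ident = Ident C, Comp = Comp C \<rparr>"

definition iso_mor :: "('k, 'o, 'm, 'z) linear_cat_scheme \<Rightarrow> 'o \<Rightarrow> 'o \<Rightarrow> 'm \<Rightarrow> bool"
  where "iso_mor C X Y f \<longleftrightarrow> X \<in> Obj C \<and> Y \<in> Obj C \<and> f \<in> Mor C X Y \<and>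
    (\<exists>g\<in>Mor C Y X. g \<cdot>\<^bsub>C\<^esub> f = Ident C X \<and> f \<cdot>\<^bsub>C\<^esub> g = Ident C Y)"

definition monic :: "('k, 'o, 'm, 'z) linear_cat_scheme \<Rightarrow> 'o \<Rightarrow> 'o \<Rightarrow> 'm \<Rightarrow> bool"
  where "monic C X Y f \<longleftrightarrow> X \<in> Obj C \<and> Y \<in> Obj C \<and> f \<in> Mor C X Y \<and>
    (\<forall>Z\<in>Obj C. \<forall>g\<in>Mor C Z X. \<forall>h\<in>Mor C Z X. f \<cdot>\<^bsub>C\<^esub> g = f \<cdot>\<^bsub>C\<^esub> h \<longrightarrow> g = h)"

definition epic :: "('k, 'o, 'm, 'z) linear_cat_scheme \<Rightarrow> 'o \<Rightarrow> 'o \<Rightarrow> 'm \<Rightarrow> bool"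
  where "epic C X Y f \<longleftrightarrow> X \<in> Obj C \<and> Y \<in> Obj C \<and> f \<in> Mor C X Y \<and>
    (\<forall>Z\<in>Obj C. \<forall>g\<in>Mor C Y Z. \<forall>h\<in>Mor C Y Z. g \<cdot>\<^bsub>C\<^esub> f = h \<cdot>\<^bsub>C\<^esub> f \<longrightarrow> g = h)"

definition zero_object :: "('k, 'o, 'm, 'z) linear_cat_scheme \<Rightarrow> 'o \<Rightarrow> bool"
  where "zero_object C Z \<longleftrightarrow> Z \<in> Obj C \<and>
    (\<forall>X\<in>Obj C. (\<exists>!f. f \<in> Mor C X Z) \<and> (\<exists>!f. f \<in> Mor C Z X))"

definition biproduct ::
    "('k, 'o, 'm, 'z) linear_cat_scheme \<Rightarrow> 'o \<Rightarrow> 'o \<Rightarrow> 'o \<Rightarrow> 'm \<Rightarrow> 'm \<Rightarrow> 'm \<Rightarrow> 'm \<Rightarrow> bool"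
  where "biproduct C X Y B i j p q \<longleftrightarrow> X \<in> Obj C \<and> Y \<in> Obj C \<and> B \<in> Obj C \<and>
    i \<in> Mor C X B \<and> j \<in> Mor C Y B \<and> p \<in> Mor C B X \<and> q \<in> Mor C B Y \<and>
    p \<cdot>\<^bsub>C\<^esub> i = Ident C X \<and> q \<cdot>\<^bsub>C\<^esub> j = Ident C Y \<and>
    p \<cdot>\<^bsub>C\<^esub> j = \<zero>\<^bsub>Hom C Y X\<^esub> \<and> q \<cdot>\<^bsub>C\<^esub> i = \<zero>\<^bsub>Hom C X Y\<^esub> \<and>
    (i \<cdot>\<^bsub>C\<^esub> p) \<oplus>\<^bsub>Hom C B B\<^esub> (j \<cdot>\<^bsub>C\<^esub> q) = Ident C B"

locale additive_category = linear_category +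
  assumes zero_object_exists: "\<exists>Z. zero_object C Z"
    and biproduct_exists: "\<lbrakk>X \<in> Obj C; Y \<in> Obj C\<rbrakk> \<Longrightarrow> \<exists>B i j p q. biproduct C X Y B i j p q"

definition is_kernel ::
    "('k, 'o, 'm, 'z) linear_cat_scheme \<Rightarrow> 'o \<Rightarrow> 'o \<Rightarrow> 'm \<Rightarrow> 'o \<Rightarrow> 'm \<Rightarrow> bool"
  where "is_kernel C X Y f N k \<longleftrightarrow> X \<in> Obj C \<and> Y \<in> Obj C \<and> N \<in> Obj C \<and>
    f \<in> Mor C X Y \<and> k \<in> Mor C N X \<and> f \<cdot>\<^bsub>C\<^esub> k = \<zero>\<^bsub>Hom C N Y\<^esub> \<and>
    (\<forall>Z\<in>Obj C. \<forall>h\<in>Mor C Z X. f \<cdot>\<^bsub>C\<^esub> h = \<zero>\<^bsub>Hom C Z Y\<^esub> \<longrightarrow>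
      (\<exists>!u. u \<in> Mor C Z N \<and> k \<cdot>\<^bsub>C\<^esub> u = h))"

definition is_cokernel ::
    "('k, 'o, 'm, 'z) linear_cat_scheme \<Rightarrow> 'o \<Rightarrow> 'o \<Rightarrow> 'm \<Rightarrow> 'o \<Rightarrow> 'm \<Rightarrow> bool"
  where "is_cokernel C X Y f Q c \<longleftrightarrow> X \<in> Obj C \<and> Y \<in> Obj C \<and> Q \<in> Obj C \<and>
    f \<in> Mor C X Y \<and> c \<in> Mor C Y Q \<and> c \<cdot>\<^bsub>C\<^esub> f = \<zero>\<^bsub>Hom C X Q\<^esub> \<and>
    (\<forall>Z\<in>Obj C. \<forall>h\<in>Mor C Y Z. h \<cdot>\<^bsub>C\<^esub> f = \<zero>\<^bsub>Hom C X Z\<^esub> \<longrightarrow>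
      (\<exists>!u. u \<in> Mor C Q Z \<and> u \<cdot>\<^bsub>C\<^esub> c = h))"

locale abelian_category = additive_category +
  assumes kernel_exists: "\<lbrakk>X \<in> Obj C; Y \<in> Obj C; f \<in> Mor C X Y\<rbrakk> \<Longrightarrow> \<exists>N k. is_kernel C X Y f N k"
    and cokernel_exists: "\<lbrakk>X \<in> Obj C; Y \<in> Obj C; f \<in> Mor C X Y\<rbrakk> \<Longrightarrow> \<exists>Q c. is_cokernel C X Y f Q c"
    and monic_is_kernel: "monic C X Y f \<Longrightarrow> \<exists>Z g. is_kernel C Y Z g X f"
    and epic_is_cokernel: "epic C X Y f \<Longrightarrow> \<exists>Z g. is_cokernel C Z X g Y f"

definition simple_object :: "('k, 'o, 'm, 'z) linear_cat_scheme \<Rightarrow> 'o \<Rightarrow> bool"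
  where "simple_object C S \<longleftrightarrow> S \<in> Obj C \<and> \<not> zero_object C S \<and>
    (\<forall>X f. monic C X S f \<longrightarrow> zero_object C X \<or> iso_mor C X S f)"

text \<open>Existence of a composition series \<open>0 = Y 0 \<subseteq> \<dots> \<subseteq> Y n = X\<close> with simple factors \<open>S j\<close>.\<close>

definition finite_length_object :: "('k, 'o, 'm, 'z) linear_cat_scheme \<Rightarrow> 'o \<Rightarrow> bool"
  where "finite_length_object C X \<longleftrightarrow>
    (\<exists>n Y i S p. zero_object C (Y 0) \<and> Y n = X \<and>
      (\<forall>j<n. monic C (Y j) (Y (Suc j)) (i j) \<and>
        is_cokernel C (Y j) (Y (Suc j)) (i j) (S j) (p j) \<and> simple_object C (S j)))"

definition locally_finite ::
    "('k, 'r) ring_scheme \<Rightarrow> ('k, 'o, 'm, 'z) linear_cat_scheme \<Rightarrow> bool"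
  where "locally_finite K C \<longleftrightarrow>
    (\<forall>X\<in>Obj C. \<forall>Y\<in>Obj C. finite_length_module K (Hom C X Y)) \<and>
    (\<forall>X\<in>Obj C. finite_length_object C X)"

definition projective :: "('k, 'o, 'm, 'z) linear_cat_scheme \<Rightarrow> 'o \<Rightarrow> bool"
  where "projective C P \<longleftrightarrow> P \<in> Obj C \<and>
    (\<forall>X Y e. epic C X Y e \<longrightarrow> (\<forall>f\<in>Mor C P Y. \<exists>g\<in>Mor C P X. e \<cdot>\<^bsub>C\<^esub> g = f))"

definition injective :: "('k, 'o, 'm, 'z) linear_cat_scheme \<Rightarrow> 'o \<Rightarrow> bool"
  where "injective C I \<longleftrightarrow> I \<in> Obj C \<and>
    (\<forall>X Y m. monic C X Y m \<longrightarrow> (\<forall>f\<in>Mor C X I. \<exists>g\<in>Mor C Y I. g \<cdot>\<^bsub>C\<^esub> m = f))"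

text \<open>A projective cover is an essential epimorphism from a projective object, and an injective
  hull is an essential monomorphism into an injective one.\<close>

definition projective_cover :: "('k, 'o, 'm, 'z) linear_cat_scheme \<Rightarrow> 'o \<Rightarrow> 'o \<Rightarrow> 'm \<Rightarrow> bool"
  where "projective_cover C X P p \<longleftrightarrow> projective C P \<and> epic C P X p \<and>
    (\<forall>Y\<in>Obj C. \<forall>g\<in>Mor C Y P. epic C Y X (p \<cdot>\<^bsub>C\<^esub> g) \<longrightarrow> epic C Y P g)"

definition injective_hull :: "('k, 'o, 'm, 'z) linear_cat_scheme \<Rightarrow> 'o \<Rightarrow> 'o \<Rightarrow> 'm \<Rightarrow> bool"
  where "injective_hull C X I i \<longleftrightarrow> injective C I \<and> monic C X I i \<and>
    (\<forall>Y\<in>Obj C. \<forall>g\<in>Mor C I Y. monic C X Y (g \<cdot>\<^bsub>C\<^esub> i) \<longrightarrow> monic C I Y g)"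

definition enough_projectives :: "('k, 'o, 'm, 'z) linear_cat_scheme \<Rightarrow> bool"
  where "enough_projectives C \<longleftrightarrow> (\<forall>X\<in>Obj C. \<exists>P p. projective_cover C X P p)"

definition Proj :: "('k, 'o, 'm, 'z) linear_cat_scheme \<Rightarrow> ('k, 'o, 'm) linear_cat"
  where "Proj C = full_subcategory C {P. projective C P}"

text \<open>The head of \<open>P\<close> is its unique simple quotient, where quotients are epimorphisms out of \<open>P\<close>
  up to isomorphism under \<open>P\<close>.\<close>

definition is_head :: "('k, 'o, 'm, 'z) linear_cat_scheme \<Rightarrow> 'o \<Rightarrow> 'o \<Rightarrow> bool"
  where "is_head C P B \<longleftrightarrow> simple_object C B \<and>
    (\<exists>p. epic C P B p \<and>
      (\<forall>S q. simple_object C S \<and> epic C P S q \<longrightarrow> (\<exists>u. iso_mor C B S u \<and> u \<cdot>\<^bsub>C\<^esub> p = q)))"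


section \<open>Pivotal tensor categories\<close>

record ('k, 'o, 'm) tensor_cat = "('k, 'o, 'm) linear_cat" +
  Unit :: "'o"
  TensorObj :: "'o \<Rightarrow> 'o \<Rightarrow> 'o"  (infixr \<open>\<boxtimes>\<index>\<close> 75)
  TensorMor :: "'m \<Rightarrow> 'm \<Rightarrow> 'm"  (infixr \<open>\<boxdot>\<index>\<close> 75)

locale tensor_category = additive_category K C
  for K :: "('k, 'r) ring_scheme" and C :: "('k, 'o, 'm, 'z) tensor_cat_scheme" (structure) +
  assumes cring: "cring K"
    and unit_in_obj: "Unit C \<in> Obj C"
    and tensor_in_obj: "\<lbrakk>X \<in> Obj C; Y \<in> Obj C\<rbrakk> \<Longrightarrow> X \<boxtimes> Y \<in> Obj C"
    and tensor_in_hom: "\<lbrakk>X \<in> Obj C; Y \<in> Obj C; Z \<in> Obj C; W \<in> Obj C; f \<in> Mor C X Y; g \<in> Mor C Z W\<rbrakk>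
      \<Longrightarrow> f \<boxdot> g \<in> Mor C (X \<boxtimes> Z) (Y \<boxtimes> W)"
    and tensor_ident: "\<lbrakk>X \<in> Obj C; Y \<in> Obj C\<rbrakk> \<Longrightarrow> Ident C X \<boxdot> Ident C Y = Ident C (X \<boxtimes> Y)"
    and tensor_comp: "\<lbrakk>X \<in> Obj C; Y \<in> Obj C; Z \<in> Obj C; X' \<in> Obj C; Y' \<in> Obj C; Z' \<in> Obj C;
      f \<in> Mor C X Y; g \<in> Mor C Y Z; f' \<in> Mor C X' Y'; g' \<in> Mor C Y' Z'\<rbrakk>
      \<Longrightarrow> (g \<cdot> f) \<boxdot> (g' \<cdot> f') = (g \<boxdot> g') \<cdot> (f \<boxdot> f')"
    and tensor_assoc_obj: "\<lbrakk>X \<in> Obj C; Y \<in> Obj C; Z \<in> Obj C\<rbrakk>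
      \<Longrightarrow> (X \<boxtimes> Y) \<boxtimes> Z = X \<boxtimes> (Y \<boxtimes> Z)"
    and tensor_unit_obj: "X \<in> Obj C \<Longrightarrow> Unit C \<boxtimes> X = X \<and> X \<boxtimes> Unit C = X"
    and tensor_assoc_mor: "\<lbrakk>X \<in> Obj C; Y \<in> Obj C; Z \<in> Obj C; X' \<in> Obj C; Y' \<in> Obj C; Z' \<in> Obj C;
      f \<in> Mor C X X'; g \<in> Mor C Y Y'; h \<in> Mor C Z Z'\<rbrakk> \<Longrightarrow> (f \<boxdot> g) \<boxdot> h = f \<boxdot> (g \<boxdot> h)"
    and tensor_unit_mor: "\<lbrakk>X \<in> Obj C; Y \<in> Obj C; f \<in> Mor C X Y\<rbrakk>
      \<Longrightarrow> Ident C (Unit C) \<boxdot> f = f \<and> f \<boxdot> Ident C (Unit C) = f"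
    and tensor_linear_left: "\<lbrakk>X \<in> Obj C; Y \<in> Obj C; Z \<in> Obj C; W \<in> Obj C; g \<in> Mor C Z W\<rbrakk>
      \<Longrightarrow> linear_map K (Hom C X Y) (Hom C (X \<boxtimes> Z) (Y \<boxtimes> W)) (\<lambda>f. f \<boxdot> g)"
    and tensor_linear_right: "\<lbrakk>X \<in> Obj C; Y \<in> Obj C; Z \<in> Obj C; W \<in> Obj C; f \<in> Mor C X Y\<rbrakk>
      \<Longrightarrow> linear_map K (Hom C Z W) (Hom C (X \<boxtimes> Z) (Y \<boxtimes> W)) (\<lambda>g. f \<boxdot> g)"
    and scalars_iso_end_unit: "bij_betw (\<lambda>a. a \<odot>\<^bsub>Hom C (Unit C) (Unit C)\<^esub> Ident C (Unit C))
      (carrier K) (Mor C (Unit C) (Unit C))"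

text \<open>Write \<open>V*\<close> for \<open>Dual V\<close> and \<open>1\<close> for the unit object. Then
  \<open>LEv V : V* V \<rightarrow> 1\<close> and \<open>LCoev V : 1 \<rightarrow> V V*\<close> make \<open>V*\<close> a left dual, while
  \<open>REv V : V V* \<rightarrow> 1\<close> and \<open>RCoev V : 1 \<rightarrow> V* V\<close> make it a right dual.\<close>

record ('k, 'o, 'm) pivotal_cat = "('k, 'o, 'm) tensor_cat" +
  Dual :: "'o \<Rightarrow> 'o"
  LEv :: "'o \<Rightarrow> 'm"
  LCoev :: "'o \<Rightarrow> 'm"
  REv :: "'o \<Rightarrow> 'm"
  RCoev :: "'o \<Rightarrow> 'm"

definition left_dual_mor :: "('k, 'o, 'm, 'z) pivotal_cat_scheme \<Rightarrow> 'o \<Rightarrow> 'o \<Rightarrow> 'm \<Rightarrow> 'm"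
  where "left_dual_mor C V W f =
    (LEv C W \<boxdot>\<^bsub>C\<^esub> Ident C (Dual C V)) \<cdot>\<^bsub>C\<^esub>
    (Ident C (Dual C W) \<boxdot>\<^bsub>C\<^esub> f \<boxdot>\<^bsub>C\<^esub> Ident C (Dual C V)) \<cdot>\<^bsub>C\<^esub>
    (Ident C (Dual C W) \<boxdot>\<^bsub>C\<^esub> LCoev C V)"

definition right_dual_mor :: "('k, 'o, 'm, 'z) pivotal_cat_scheme \<Rightarrow> 'o \<Rightarrow> 'o \<Rightarrow> 'm \<Rightarrow> 'm"
  where "right_dual_mor C V W f =
    (Ident C (Dual C V) \<boxdot>\<^bsub>C\<^esub> REv C W) \<cdot>\<^bsub>C\<^esub>
    (Ident C (Dual C V) \<boxdot>\<^bsub>C\<^esub> f \<boxdot>\<^bsub>C\<^esub> Ident C (Dual C W)) \<cdot>\<^bsub>C\<^esub>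
    (RCoev C V \<boxdot>\<^bsub>C\<^esub> Ident C (Dual C W))"

text \<open>The two canonical isomorphisms \<open>W* V* \<rightarrow> (V W)*\<close>.\<close>

definition left_dual_tensor :: "('k, 'o, 'm, 'z) pivotal_cat_scheme \<Rightarrow> 'o \<Rightarrow> 'o \<Rightarrow> 'm"
  where "left_dual_tensor C V W =
    (LEv C W \<boxdot>\<^bsub>C\<^esub> Ident C (Dual C (V \<boxtimes>\<^bsub>C\<^esub> W))) \<cdot>\<^bsub>C\<^esub>
    (Ident C (Dual C W) \<boxdot>\<^bsub>C\<^esub> LEv C V \<boxdot>\<^bsub>C\<^esub> Ident C W \<boxdot>\<^bsub>C\<^esub> Ident C (Dual C (V \<boxtimes>\<^bsub>C\<^esub> W))) \<cdot>\<^bsub>C\<^esub>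
    (Ident C (Dual C W) \<boxdot>\<^bsub>C\<^esub> Ident C (Dual C V) \<boxdot>\<^bsub>C\<^esub> LCoev C (V \<boxtimes>\<^bsub>C\<^esub> W))"

definition right_dual_tensor :: "('k, 'o, 'm, 'z) pivotal_cat_scheme \<Rightarrow> 'o \<Rightarrow> 'o \<Rightarrow> 'm"
  where "right_dual_tensor C V W =
    (Ident C (Dual C (V \<boxtimes>\<^bsub>C\<^esub> W)) \<boxdot>\<^bsub>C\<^esub> REv C V) \<cdot>\<^bsub>C\<^esub>
    (Ident C (Dual C (V \<boxtimes>\<^bsub>C\<^esub> W)) \<boxdot>\<^bsub>C\<^esub> Ident C V \<boxdot>\<^bsub>C\<^esub> REv C W \<boxdot>\<^bsub>C\<^esub> Ident C (Dual C V)) \<cdot>\<^bsub>C\<^esub>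
    (RCoev C (V \<boxtimes>\<^bsub>C\<^esub> W) \<boxdot>\<^bsub>C\<^esub> Ident C (Dual C W) \<boxdot>\<^bsub>C\<^esub> Ident C (Dual C V))"

locale pivotal_tensor_category = tensor_category K C
  for K :: "('k, 'r) ring_scheme" and C :: "('k, 'o, 'm, 'z) pivotal_cat_scheme" (structure) +
  assumes dual_in_obj: "V \<in> Obj C \<Longrightarrow> Dual C V \<in> Obj C"
    and lev_in_hom: "V \<in> Obj C \<Longrightarrow> LEv C V \<in> Mor C (Dual C V \<boxtimes> V) (Unit C)"
    and lcoev_in_hom: "V \<in> Obj C \<Longrightarrow> LCoev C V \<in> Mor C (Unit C) (V \<boxtimes> Dual C V)"
    and rev_in_hom: "V \<in> Obj C \<Longrightarrow> REv C V \<in> Mor C (V \<boxtimes> Dual C V) (Unit C)"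
    and rcoev_in_hom: "V \<in> Obj C \<Longrightarrow> RCoev C V \<in> Mor C (Unit C) (Dual C V \<boxtimes> V)"
    and left_zigzag: "V \<in> Obj C \<Longrightarrow>
      (Ident C V \<boxdot> LEv C V) \<cdot> (LCoev C V \<boxdot> Ident C V) = Ident C V"
    and left_zigzag_dual: "V \<in> Obj C \<Longrightarrow>
      (LEv C V \<boxdot> Ident C (Dual C V)) \<cdot> (Ident C (Dual C V) \<boxdot> LCoev C V) = Ident C (Dual C V)"
    and right_zigzag: "V \<in> Obj C \<Longrightarrow>
      (REv C V \<boxdot> Ident C V) \<cdot> (Ident C V \<boxdot> RCoev C V) = Ident C V"
    and right_zigzag_dual: "V \<in> Obj C \<Longrightarrow>
      (Ident C (Dual C V) \<boxdot> REv C V) \<cdot> (RCoev C V \<boxdot> Ident C (Dual C V)) = Ident C (Dual C V)"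
    and dual_mor_coincide: "\<lbrakk>V \<in> Obj C; W \<in> Obj C; f \<in> Mor C V W\<rbrakk>
      \<Longrightarrow> left_dual_mor C V W f = right_dual_mor C V W f"
    and dual_tensor_coincide: "\<lbrakk>V \<in> Obj C; W \<in> Obj C\<rbrakk>
      \<Longrightarrow> left_dual_tensor C V W = right_dual_tensor C V W"


section \<open>Twisted Calabi-Yau categories and Serre functors\<close>

record ('o, 'm) functor_maps =
  OnObj :: "'o \<Rightarrow> 'o"
  OnMor :: "'m \<Rightarrow> 'm"

definition endofunctor :: "('k, 'o, 'm, 'z) linear_cat_scheme \<Rightarrow> ('o, 'm) functor_maps \<Rightarrow> bool"
  where "endofunctor D F \<longleftrightarrow>
    (\<forall>X\<in>Obj D. OnObj F X \<in> Obj D) \<and>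
    (\<forall>X\<in>Obj D. \<forall>Y\<in>Obj D. \<forall>f\<in>Mor D X Y. OnMor F f \<in> Mor D (OnObj F X) (OnObj F Y)) \<and>
    (\<forall>X\<in>Obj D. OnMor F (Ident D X) = Ident D (OnObj F X)) \<and>
    (\<forall>X\<in>Obj D. \<forall>Y\<in>Obj D. \<forall>Z\<in>Obj D. \<forall>f\<in>Mor D X Y. \<forall>g\<in>Mor D Y Z.
      OnMor F (g \<cdot>\<^bsub>D\<^esub> f) = OnMor F g \<cdot>\<^bsub>D\<^esub> OnMor F f)"

definition identity_functor :: "('o, 'm) functor_maps"
  where "identity_functor = \<lparr> OnObj = (\<lambda>X. X), OnMor = (\<lambda>f. f) \<rparr>"

definition left_tensor_functor ::
    "('k, 'o, 'm, 'z) tensor_cat_scheme \<Rightarrow> 'o \<Rightarrow> ('o, 'm) functor_maps"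
  where "left_tensor_functor C B =
    \<lparr> OnObj = (\<lambda>X. B \<boxtimes>\<^bsub>C\<^esub> X), OnMor = (\<lambda>f. Ident C B \<boxdot>\<^bsub>C\<^esub> f) \<rparr>"

definition twisted_calabi_yau_trace ::
    "('k, 'r) ring_scheme \<Rightarrow> ('k, 'o, 'm, 'z) linear_cat_scheme \<Rightarrow>
     ('o, 'm) functor_maps \<Rightarrow> ('o, 'm) functor_maps \<Rightarrow> ('o \<Rightarrow> 'm \<Rightarrow> 'k) \<Rightarrow> bool"
  where "twisted_calabi_yau_trace K D F G t \<longleftrightarrow>
    (\<forall>U\<in>Obj D. linear_form K (Hom D (OnObj F U) (OnObj G U)) (t U)) \<and>
    (\<forall>U\<in>Obj D. \<forall>V\<in>Obj D.
      nondegenerate K (Hom D V (OnObj G U)) (Hom D (OnObj F U) V) (\<lambda>g f. t U (g \<cdot>\<^bsub>D\<^esub> f))) \<and>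
    (\<forall>U\<in>Obj D. \<forall>V\<in>Obj D. \<forall>f\<in>Mor D (OnObj F V) (OnObj G U). \<forall>g\<in>Mor D U V.
      t V (OnMor G g \<cdot>\<^bsub>D\<^esub> f) = t U (f \<cdot>\<^bsub>D\<^esub> OnMor F g))"

definition twisted_calabi_yau ::
    "('k, 'r) ring_scheme \<Rightarrow> ('k, 'o, 'm, 'z) linear_cat_scheme \<Rightarrow>
     ('o, 'm) functor_maps \<Rightarrow> ('o, 'm) functor_maps \<Rightarrow> bool"
  where "twisted_calabi_yau K D F G \<longleftrightarrow>
    linear_category K D \<and> endofunctor D F \<and> endofunctor D G \<and>
    (\<exists>t. twisted_calabi_yau_trace K D F G t)"

text \<open>The last two clauses are naturality in \<open>U\<close> and \<open>V\<close> of the family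
  \<open>\<eta> U V : Hom(U, V) \<rightarrow> Hom(V, G U)*\<close>; both sides are contravariant in \<open>U\<close> and covariant
  in \<open>V\<close>.\<close>

definition right_serre_functor ::
    "('k, 'r) ring_scheme \<Rightarrow> ('k, 'o, 'm, 'z) linear_cat_scheme \<Rightarrow> ('o, 'm) functor_maps \<Rightarrow> bool"
  where "right_serre_functor K D G \<longleftrightarrow>
    linear_category K D \<and> endofunctor D G \<and>
    (\<exists>\<eta> :: 'o \<Rightarrow> 'o \<Rightarrow> 'm \<Rightarrow> 'm \<Rightarrow> 'k.
      (\<forall>U\<in>Obj D. \<forall>V\<in>Obj D.
        linear_iso K (Hom D U V) (dual_module K (Hom D V (OnObj G U))) (\<eta> U V)) \<and>
      (\<forall>U\<in>Obj D. \<forall>U'\<in>Obj D. \<forall>V\<in>Obj D.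
        \<forall>h\<in>Mor D U' U. \<forall>f\<in>Mor D U V. \<forall>g\<in>Mor D V (OnObj G U').
          \<eta> U' V (f \<cdot>\<^bsub>D\<^esub> h) g = \<eta> U V f (OnMor G h \<cdot>\<^bsub>D\<^esub> g)) \<and>
      (\<forall>U\<in>Obj D. \<forall>V\<in>Obj D. \<forall>V'\<in>Obj D.
        \<forall>h\<in>Mor D V V'. \<forall>f\<in>Mor D U V. \<forall>g\<in>Mor D V' (OnObj G U).
          \<eta> U V' (h \<cdot>\<^bsub>D\<^esub> f) g = \<eta> U V f (g \<cdot>\<^bsub>D\<^esub> h)))"

end

theory Submission
  imports Defs
begin

text \<open>Let \<open>V*\<close> denote the dual of \<open>V\<close>, let \<open>i : 1 \<rightarrow> P\<close> be the hull and \<open>p : P \<rightarrow> \<beta>\<close> the projection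
  to the head. For projective \<open>W\<close> there is a pairing between \<open>Hom(W, \<beta>)\<close> and \<open>Hom(1, W)\<close>: lift
  \<open>m : W \<rightarrow> \<beta>\<close> through \<open>p\<close> to \<open>h : W \<rightarrow> P\<close>; then \<open>h x : 1 \<rightarrow> P\<close> is a multiple of \<open>i\<close>, and
  the scalar is the value at \<open>x : 1 \<rightarrow> W\<close>. The twisted trace of \<open>g : U \<rightarrow> \<beta> U\<close> is the value at the
  coevaluation of \<open>U\<close> of the morphism \<open>U U* \<rightarrow> \<beta>\<close> obtained from \<open>g\<close> by bending \<open>U\<close>.

  Everything rests on one dichotomy (\<open>hull_endo_iso\<close>): an endomorphism of \<open>P\<close> is either
  invertible or kills \<open>i\<close>, because \<open>Hom(1, P)\<close> is spanned by \<open>i\<close> and \<open>P\<close> is injective. As \<open>p\<close> is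
  nonzero, an endomorphism \<open>f\<close> with \<open>p f = 0\<close> kills \<open>i\<close>. This makes the scalar independent
  of the lift: a difference \<open>d\<close> of lifts satisfies \<open>p d = 0\<close>, and \<open>x\<close> factors as \<open>e i\<close> because \<open>W\<close>
  is injective, so that \<open>d x = (d e) i = 0\<close>. It also makes the pairing non-degenerate: a nonzero
  \<open>m : W \<rightarrow> \<beta>\<close> is epic, hence \<open>m e = p\<close> for some \<open>e : P \<rightarrow> W\<close>, and a lift \<open>h\<close> of \<open>m\<close> cannot kill \<open>e i\<close>
  because \<open>p (1 - h e) = 0\<close>; a nonzero \<open>x : 1 \<rightarrow> W\<close> is monic, hence \<open>s x = i\<close> for some
  \<open>s : W \<rightarrow> P\<close>, and \<open>p s\<close> pairs to 1 with \<open>x\<close>. By rigidity, the pairing for \<open>W = V U*\<close> is the one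
  between \<open>Hom(V, \<beta> U)\<close> and \<open>Hom(U, V)\<close> induced by the trace.

  Cyclicity is the statement that a morphism \<open>g : U \<rightarrow> V\<close> can be pulled through the left
  coevaluation and through the right evaluation by the same \<open>g* : V* \<rightarrow> U*\<close>, i.e. that its left
  and right duals coincide (\<open>dual_mate\<close>).

  Three structural facts feed the argument: the unit object is simple (\<open>unit_simple\<close>),
  projective objects are injective (\<open>projective_imp_injective\<close>), and \<open>P\<close> is projective
  (\<open>hull_projective\<close>). Finally, since the spaces of morphisms have finite length, a non-degenerate
  pairing identifies each of them with the dual of the other (\<open>nondegenerate_represents_form\<close>),
  which turns the trace into a Serre functor (\<open>calabi_yau_right_serre\<close>).\<close>

(* frees the centred dot for composition of morphisms *)
no_notation Ideal_Product.ideal_prod (infixl "\<cdot>\<index>" 80)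

section \<open>Linear forms and non-degenerate pairings\<close>

lemma linear_formD:
  assumes "linear_form K M \<phi>"
  shows "\<phi> \<in> carrier M \<rightarrow> carrier K"
    and "\<And>x. x \<in> carrier M \<Longrightarrow> \<phi> x \<in> carrier K"
    and "\<And>x y. \<lbrakk>x \<in> carrier M; y \<in> carrier M\<rbrakk> \<Longrightarrow> \<phi> (x \<oplus>\<^bsub>M\<^esub> y) = \<phi> x \<oplus>\<^bsub>K\<^esub> \<phi> y"
    and "\<And>a x. \<lbrakk>a \<in> carrier K; x \<in> carrier M\<rbrakk> \<Longrightarrow> \<phi> (a \<odot>\<^bsub>M\<^esub> x) = a \<otimes>\<^bsub>K\<^esub> \<phi> x"
  using assms unfolding linear_form_def by auto

lemma linear_mapD:
  assumes "linear_map K M N h"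
  shows "\<And>x. x \<in> carrier M \<Longrightarrow> h x \<in> carrier N"
    and "\<And>x y. \<lbrakk>x \<in> carrier M; y \<in> carrier M\<rbrakk> \<Longrightarrow> h (x \<oplus>\<^bsub>M\<^esub> y) = h x \<oplus>\<^bsub>N\<^esub> h y"
    and "\<And>a x. \<lbrakk>a \<in> carrier K; x \<in> carrier M\<rbrakk> \<Longrightarrow> h (a \<odot>\<^bsub>M\<^esub> x) = a \<odot>\<^bsub>N\<^esub> h x"
  using assms unfolding linear_map_def by auto

lemma (in module) minus_eq_smult:
  "x \<in> carrier M \<Longrightarrow> \<ominus>\<^bsub>M\<^esub> x = (\<ominus>\<^bsub>R\<^esub> \<one>\<^bsub>R\<^esub>) \<odot>\<^bsub>M\<^esub> x"
  by (simp add: smult_l_minus)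

lemma linear_map_zero:
  assumes "module K M" "module K N" "linear_map K M N h"
  shows "h \<zero>\<^bsub>M\<^esub> = \<zero>\<^bsub>N\<^esub>"
proof -
  interpret M: module K M by fact
  interpret N: module K N by fact
  show ?thesis
    using linear_mapD(3)[OF assms(3), of "\<zero>\<^bsub>K\<^esub>" "\<zero>\<^bsub>M\<^esub>"] linear_mapD(1)[OF assms(3), of "\<zero>\<^bsub>M\<^esub>"]
    by simp
qed

lemma linear_map_minus:
  assumes "module K M" "module K N" "linear_map K M N h" "x \<in> carrier M" "y \<in> carrier M"
  shows "h (x \<ominus>\<^bsub>M\<^esub> y) = h x \<ominus>\<^bsub>N\<^esub> h y"
proof -
  interpret M: module K M by fact
  interpret N: module K N by fact
  show ?thesis
    using assms(4,5) linear_mapD[OF assms(3)]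
    by (simp add: M.minus_eq N.minus_eq M.minus_eq_smult N.minus_eq_smult)
qed

lemma linear_form_minus:
  assumes "module K M" "linear_form K M \<phi>" "x \<in> carrier M" "y \<in> carrier M"
  shows "\<phi> (x \<ominus>\<^bsub>M\<^esub> y) = \<phi> x \<ominus>\<^bsub>K\<^esub> \<phi> y"
proof -
  interpret M: module K M by fact
  show ?thesis
    using assms(3,4) linear_formD[OF assms(2)]
    by (simp add: M.minus_eq M.R.minus_eq M.minus_eq_smult M.R.l_minus)
qed

text \<open>Climb a composition series of \<open>N\<close>, carrying a linear projection \<open>\<pi>\<close> onto the current
  submodule such that \<open>\<psi> \<circ> \<pi>\<close> is represented by an element of \<open>M\<close> for every linear form \<open>\<psi>\<close>.
  Over a field, one further vector \<open>w\<close> with \<open>\<pi> w = 0\<close> reaches the next submodule, and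
  non-degeneracy supplies the coefficient function of \<open>w\<close>.\<close>

lemma nondegenerate_represents_form:
  assumes K: "field K" and M: "module K M" and N: "module K N"
    and fin: "finite_length_module K N"
    and Bl: "\<And>y. y \<in> carrier N \<Longrightarrow> linear_form K M (\<lambda>x. B x y)"
    and Br: "\<And>x. x \<in> carrier M \<Longrightarrow> linear_form K N (B x)"
    and nd: "\<And>y. \<lbrakk>y \<in> carrier N; \<forall>x\<in>carrier M. B x y = \<zero>\<^bsub>K\<^esub>\<rbrakk> \<Longrightarrow> y = \<zero>\<^bsub>N\<^esub>"
    and \<phi>: "linear_form K N \<phi>"
  shows "\<exists>x\<in>carrier M. \<forall>y\<in>carrier N. B x y = \<phi> y"
proof -
  interpret K: field K by fact
  interpret M: module K M by fact
  interpret N: module K N by fact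
  obtain n S where S0: "S 0 = {\<zero>\<^bsub>N\<^esub>}" and Sn: "S n = carrier N"
    and sub: "\<And>j. j \<le> n \<Longrightarrow> submodule (S j) K N"
    and step: "\<And>j. j < n \<Longrightarrow> S j \<subset> S (Suc j)"
    and simp: "\<And>j L. \<lbrakk>j < n; submodule L K N; S j \<subset> L; L \<subset> S (Suc j)\<rbrakk> \<Longrightarrow> False"
  proof -
    from fin obtain n S where *: "S 0 = {\<zero>\<^bsub>N\<^esub>}" "S n = carrier N" "\<forall>j\<le>n. submodule (S j) K N"
      "\<forall>j<n. S j \<subset> S (Suc j) \<and> \<not> (\<exists>L. submodule L K N \<and> S j \<subset> L \<and> L \<subset> S (Suc j))"
      unfolding finite_length_module_def by (elim exE conjE)
    show thesis by (rule that[of S n]) (use * in auto)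
  qed
  note Bl1 = linear_formD[OF Bl] and Br1 = linear_formD[OF Br]
  define good where "good \<pi> L \<longleftrightarrow> linear_map K N N \<pi> \<and> (\<forall>y\<in>carrier N. \<pi> y \<in> L) \<and> (\<forall>y\<in>L. \<pi> y = y) \<and>
    (\<forall>\<psi>. linear_form K N \<psi> \<longrightarrow> (\<exists>x\<in>carrier M. \<forall>y\<in>carrier N. B x y = \<psi> (\<pi> y)))" for \<pi> L
  have "\<exists>\<pi>. good \<pi> (S j)" if "j \<le> n" for j
    using that
  proof (induction j)
    case 0
    have "B \<zero>\<^bsub>M\<^esub> y = \<psi> \<zero>\<^bsub>N\<^esub>" if "linear_form K N \<psi>" "y \<in> carrier N" for y \<psi>
      using linear_formD(4)[OF that(1), of "\<zero>\<^bsub>K\<^esub>" "\<zero>\<^bsub>N\<^esub>"] Bl1(4)[OF that(2), of "\<zero>\<^bsub>K\<^esub>" "\<zero>\<^bsub>M\<^esub>"]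
        linear_formD(2)[OF that(1), of "\<zero>\<^bsub>N\<^esub>"] Bl1(2)[OF that(2), of "\<zero>\<^bsub>M\<^esub>"] by simp
    then have "good (\<lambda>y. \<zero>\<^bsub>N\<^esub>) (S 0)"
      unfolding good_def S0 linear_map_def by auto
    then show ?case by blast
  next
    case (Suc j)
    then obtain \<pi> where \<pi>: "good \<pi> (S j)" and j: "j < n" by auto
    have \<pi>lin: "linear_map K N N \<pi>" and \<pi>in: "\<And>y. y \<in> carrier N \<Longrightarrow> \<pi> y \<in> S j"
      and \<pi>id: "\<And>y. y \<in> S j \<Longrightarrow> \<pi> y = y"
      and \<pi>rep: "\<And>\<psi>. linear_form K N \<psi> \<Longrightarrow> \<exists>x\<in>carrier M. \<forall>y\<in>carrier N. B x y = \<psi> (\<pi> y)"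
      using \<pi> unfolding good_def by auto
    note \<pi>1 = linear_mapD[OF \<pi>lin]
    have subj: "submodule (S j) K N" and subj': "submodule (S (Suc j)) K N"
      using sub j by auto
    note sj = N.submoduleE[OF subj] and sj' = N.submoduleE[OF subj']
    obtain v where v: "v \<in> S (Suc j)" "v \<notin> S j" using step[OF j] by blast
    have vN: "v \<in> carrier N" using v sj' by auto
    \<comment> \<open>the part of \<open>v\<close> not yet reached: \<open>\<pi> w = 0\<close>\<close>
    define w where "w = v \<ominus>\<^bsub>N\<^esub> \<pi> v"
    have wN: "w \<in> carrier N" using vN \<pi>1 w_def by simp
    have ws: "w \<in> S (Suc j)"
      unfolding w_def N.minus_eq using v(1) \<pi>in[OF vN] step[OF j] sj' by (meson psubsetD)
    have vw: "v = \<pi> v \<oplus>\<^bsub>N\<^esub> w"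
      unfolding w_def using vN \<pi>1(1)[OF vN] by (simp add: N.minus_eq N.a_ac N.r_neg N.r_neg1 N.r_neg2)
    have "w \<noteq> \<zero>\<^bsub>N\<^esub>"
      using vw v(2) \<pi>in[OF vN] \<pi>1(1)[OF vN] by force
    then obtain x0 where x0: "x0 \<in> carrier M" "B x0 w \<noteq> \<zero>\<^bsub>K\<^esub>" using nd wN by blast
    define x1 where "x1 = (inv\<^bsub>K\<^esub> B x0 w) \<odot>\<^bsub>M\<^esub> x0"
    have bU: "B x0 w \<in> Units K" using x0 Bl1(2)[OF wN] K.field_Units by auto
    have x1: "x1 \<in> carrier M" and "B x1 w = \<one>\<^bsub>K\<^esub>"
      using x0 bU Bl1(4)[OF wN] unfolding x1_def by auto
    obtain x2 where x2: "x2 \<in> carrier M" "\<And>y. y \<in> carrier N \<Longrightarrow> B x2 y = B x1 (\<pi> y)"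
      using \<pi>rep[OF Br[OF x1]] by blast
    \<comment> \<open>\<open>B x\<close> vanishes on the range of \<open>\<pi>\<close> and takes the value 1 at \<open>w\<close>: it is the coefficient of \<open>w\<close>\<close>
    define x where "x = x1 \<ominus>\<^bsub>M\<^esub> x2"
    have x: "x \<in> carrier M" using x1 x2 x_def by simp
    have Bx: "B x y = B x1 y \<ominus>\<^bsub>K\<^esub> B x1 (\<pi> y)" if "y \<in> carrier N" for y
      using linear_form_minus[OF M Bl[OF that] x1 x2(1)] x2(2)[OF that] unfolding x_def by simp
    note x' = Br1[OF x]
    have \<pi>\<pi>: "\<pi> (\<pi> y) = \<pi> y" if "y \<in> carrier N" for y using \<pi>id \<pi>in that by simp
    have \<pi>w: "\<pi> w = \<zero>\<^bsub>N\<^esub>"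
      unfolding w_def using linear_map_minus[OF N N \<pi>lin vN \<pi>1(1)[OF vN]] \<pi>\<pi>[OF vN] \<pi>1(1)[OF vN]
      by (simp add: N.minus_eq N.r_neg)
    have B10: "B x1 \<zero>\<^bsub>N\<^esub> = \<zero>\<^bsub>K\<^esub>"
      using Br1(4)[OF x1, of "\<zero>\<^bsub>K\<^esub>" "\<zero>\<^bsub>N\<^esub>"] Br1(2)[OF x1, of "\<zero>\<^bsub>N\<^esub>"] by simp
    have Bxw: "B x w = \<one>\<^bsub>K\<^esub>"
      using Bx[OF wN] \<open>B x1 w = \<one>\<^bsub>K\<^esub>\<close> \<pi>w B10 by (simp add: K.minus_eq)
    have BxS: "B x y = \<zero>\<^bsub>K\<^esub>" if "y \<in> S j" for y
    proof -
      have "y \<in> carrier N" using that sj by auto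
      then show ?thesis using Bx \<pi>id[OF that] Br1(2)[OF x1] by (simp add: K.minus_eq K.r_neg)
    qed
    define \<rho> where "\<rho> y = \<pi> y \<oplus>\<^bsub>N\<^esub> B x y \<odot>\<^bsub>N\<^esub> w" for y
    have \<rho>lin: "linear_map K N N \<rho>"
      unfolding linear_map_def \<rho>_def using \<pi>1 x' wN
      by (auto simp: N.smult_l_distr N.smult_r_distr N.smult_assoc1 N.a_ac)
    note \<rho>1 = linear_mapD[OF \<rho>lin]
    have \<rho>in: "\<rho> y \<in> S (Suc j)" if "y \<in> carrier N" for y
      unfolding \<rho>_def using that \<pi>in[OF that] step[OF j] ws x'(2)[OF that] sj' by (meson psubsetD)
    \<comment> \<open>\<open>L\<close> strictly contains \<open>S j\<close>, so it is all of \<open>S (Suc j)\<close> by simplicity of the factor\<close>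
    define L where "L = {y \<in> S (Suc j). \<rho> y = y}"
    have Lsub: "submodule L K N"
    proof (rule N.submoduleI)
      show "L \<subseteq> carrier N" using sj' L_def by auto
      have z: "\<zero>\<^bsub>N\<^esub> \<in> S (Suc j)" using submodule.axioms(1)[OF subj'] subgroup.one_closed by fastforce
      show "\<zero>\<^bsub>N\<^esub> \<in> L"
        using linear_map_zero[OF N N \<rho>lin] z by (simp add: L_def)
      show "\<ominus>\<^bsub>N\<^esub> a \<in> L" if "a \<in> L" for a
      proof -
        have aN: "a \<in> carrier N" using that sj' L_def by auto
        show ?thesis using that sj' \<rho>1(3)[OF _ aN, of "\<ominus>\<^bsub>K\<^esub> \<one>\<^bsub>K\<^esub>"] aN
          by (auto simp: L_def N.minus_eq_smult)
      qed
      show "a \<oplus>\<^bsub>N\<^esub> b \<in> L" if "a \<in> L" "b \<in> L" for a b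
        using that sj'(1,5) \<rho>1(2) unfolding L_def by (simp add: subset_iff)
      show "a \<odot>\<^bsub>N\<^esub> b \<in> L" if "a \<in> carrier K" "b \<in> L" for a b
        using that sj'(1,4) \<rho>1(3) unfolding L_def by (simp add: subset_iff)
    qed
    have "S j \<subseteq> L"
      using step[OF j] sj(1) \<pi>id BxS wN by (auto simp: L_def \<rho>_def subset_iff)
    moreover have "w \<in> L" using ws wN \<pi>w Bxw by (simp add: L_def \<rho>_def)
    moreover have "w \<notin> S j" using \<pi>id \<pi>w \<open>w \<noteq> \<zero>\<^bsub>N\<^esub>\<close> by force
    moreover have "L \<subseteq> S (Suc j)" by (auto simp: L_def)
    ultimately have "L = S (Suc j)" using simp[OF j Lsub] by blast
    then have \<rho>id: "\<rho> y = y" if "y \<in> S (Suc j)" for y using that L_def by blast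
    have "\<exists>z\<in>carrier M. \<forall>y\<in>carrier N. B z y = \<psi> (\<rho> y)" if \<psi>: "linear_form K N \<psi>" for \<psi>
    proof -
      note \<psi>1 = linear_formD[OF \<psi>]
      obtain z where z: "z \<in> carrier M" "\<And>y. y \<in> carrier N \<Longrightarrow> B z y = \<psi> (\<pi> y)"
        using \<pi>rep[OF \<psi>] by blast
      have "B (z \<oplus>\<^bsub>M\<^esub> \<psi> w \<odot>\<^bsub>M\<^esub> x) y = \<psi> (\<rho> y)" if y: "y \<in> carrier N" for y
        unfolding \<rho>_def using y z x wN \<psi>1 Bl1[OF y] x' \<pi>1 by (simp add: K.m_comm)
      then show ?thesis using z x wN \<psi>1(2) by (intro bexI[of _ "z \<oplus>\<^bsub>M\<^esub> \<psi> w \<odot>\<^bsub>M\<^esub> x"]) auto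
    qed
    then have "good \<rho> (S (Suc j))" unfolding good_def using \<rho>lin \<rho>in \<rho>id by auto
    then show ?case by blast
  qed
  then obtain \<pi> where "good \<pi> (S n)" by blast
  then show ?thesis unfolding good_def Sn using \<phi> by (metis (no_types, lifting))
qed

section \<open>Morphisms of linear and abelian categories\<close>

lemma (in abelian_group) minus_eq_zero_iff:
  assumes "x \<in> carrier G" "y \<in> carrier G"
  shows "x \<ominus> y = \<zero> \<longleftrightarrow> x = y"
  using assms minus_equality[of x "\<ominus> y"] minus_minus[of y] r_neg[of y] by (auto simp: minus_eq)

context linear_category
begin

text \<open>Since the sets of morphisms are disjoint, every morphism determines its source and target. With
  these as functions, the typing conditions of equations between morphisms become rewriting goals
  that mention no further variables.\<close>

definition arr :: "'m \<Rightarrow> bool"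
  where "arr f \<longleftrightarrow> (\<exists>X\<in>Obj C. \<exists>Y\<in>Obj C. f \<in> Mor C X Y)"

definition src :: "'m \<Rightarrow> 'o"
  where "src f = (THE X. X \<in> Obj C \<and> (\<exists>Y\<in>Obj C. f \<in> Mor C X Y))"

definition tgt :: "'m \<Rightarrow> 'o"
  where "tgt f = (THE Y. Y \<in> Obj C \<and> (\<exists>X\<in>Obj C. f \<in> Mor C X Y))"

abbreviation zero_mor :: "'o \<Rightarrow> 'o \<Rightarrow> 'm"
  where "zero_mor X Y \<equiv> \<zero>\<^bsub>Hom C X Y\<^esub>"

lemma mor_iff:
  assumes "X \<in> Obj C" "Y \<in> Obj C"
  shows "f \<in> Mor C X Y \<longleftrightarrow> arr f \<and> src f = X \<and> tgt f = Y"
proof -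
  have *: "src f = X' \<and> tgt f = Y'" if "X' \<in> Obj C" "Y' \<in> Obj C" "f \<in> Mor C X' Y'" for X' Y'
    unfolding src_def tgt_def using that hom_disjoint by (intro conjI the_equality) blast+
  show ?thesis unfolding arr_def using * assms by blast
qed

lemma src_tgt_obj [simp]: "arr f \<Longrightarrow> src f \<in> Obj C" "arr f \<Longrightarrow> tgt f \<in> Obj C"
  unfolding arr_def using mor_iff by (metis arr_def)+

lemma arr_mor: "arr f \<Longrightarrow> f \<in> Mor C (src f) (tgt f)"
  using mor_iff by simp

lemma ident_arr [simp]:
  assumes "X \<in> Obj C"
  shows "arr (Ident C X)" "src (Ident C X) = X" "tgt (Ident C X) = X"
  using ident_in_hom[OF assms] mor_iff assms by auto

lemma zero_arr [simp]:
  assumes "X \<in> Obj C" "Y \<in> Obj C"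
  shows "arr (zero_mor X Y)" "src (zero_mor X Y) = X" "tgt (zero_mor X Y) = Y"
proof -
  interpret module K "Hom C X Y" using hom_module assms .
  show "arr (zero_mor X Y)" "src (zero_mor X Y) = X" "tgt (zero_mor X Y) = Y"
    using mor_iff[OF assms, of "zero_mor X Y"] by auto
qed

lemma comp_arr [simp]:
  assumes "arr g" "arr f" "src g = tgt f"
  shows "arr (g \<cdot> f)" "src (g \<cdot> f) = src f" "tgt (g \<cdot> f) = tgt g"
  using comp_in_hom[of "src f" "tgt f" "tgt g" g f] assms mor_iff by auto

lemma comp_ident_left [simp]: "\<lbrakk>arr f; tgt f = Y\<rbrakk> \<Longrightarrow> Ident C Y \<cdot> f = f"
  using comp_ident[of "src f" "tgt f" f] arr_mor by auto

lemma comp_ident_right [simp]: "\<lbrakk>arr f; src f = X\<rbrakk> \<Longrightarrow> f \<cdot> Ident C X = f"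
  using comp_ident[of "src f" "tgt f" f] arr_mor by auto

lemma comp_assoc_arr [simp]:
  "\<lbrakk>arr h; arr g; arr f; src h = tgt g; src g = tgt f\<rbrakk> \<Longrightarrow> (h \<cdot> g) \<cdot> f = h \<cdot> (g \<cdot> f)"
  using comp_assoc[of "src f" "tgt f" "tgt g" "tgt h" h g f] arr_mor[of f] arr_mor[of g] arr_mor[of h]
  by auto

lemma comp_zero_right [simp]:
  assumes "arr g" "src g = Y" "X \<in> Obj C"
  shows "g \<cdot> zero_mor X Y = zero_mor X (tgt g)"
  using assms comp_linear_right[of X "src g" "tgt g" g] arr_mor[of g]
  by (auto intro!: linear_map_zero[where h = "\<lambda>f. g \<cdot> f" and K = K] hom_module)

lemma comp_zero_left [simp]:
  assumes "arr f" "tgt f = Y" "Z \<in> Obj C"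
  shows "zero_mor Y Z \<cdot> f = zero_mor (src f) Z"
  using assms comp_linear_left[of "src f" "tgt f" Z f] arr_mor[of f]
  by (auto intro!: linear_map_zero[where h = "\<lambda>g. g \<cdot> f" and K = K] hom_module)

lemma comp_minus_left:
  assumes "g \<in> Mor C Y Z" "h \<in> Mor C Y Z" "f \<in> Mor C X Y" "X \<in> Obj C" "Y \<in> Obj C" "Z \<in> Obj C"
  shows "(g \<ominus>\<^bsub>Hom C Y Z\<^esub> h) \<cdot> f = g \<cdot> f \<ominus>\<^bsub>Hom C X Z\<^esub> h \<cdot> f"
  by (rule linear_map_minus[where h = "\<lambda>g. g \<cdot> f" and K = K])
    (use assms hom_module comp_linear_left in auto)

lemma comp_minus_right:
  assumes "f \<in> Mor C X Y" "h \<in> Mor C X Y" "g \<in> Mor C Y Z" "X \<in> Obj C" "Y \<in> Obj C" "Z \<in> Obj C"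
  shows "g \<cdot> (f \<ominus>\<^bsub>Hom C X Y\<^esub> h) = g \<cdot> f \<ominus>\<^bsub>Hom C X Z\<^esub> g \<cdot> h"
  by (rule linear_map_minus[where h = "\<lambda>f. g \<cdot> f" and K = K])
    (use assms hom_module comp_linear_right in auto)

lemma minus_arr:
  assumes "arr f" "arr g" "src f = X" "src g = X" "tgt f = Y" "tgt g = Y"
  shows "arr (f \<ominus>\<^bsub>Hom C X Y\<^esub> g)" "src (f \<ominus>\<^bsub>Hom C X Y\<^esub> g) = X" "tgt (f \<ominus>\<^bsub>Hom C X Y\<^esub> g) = Y"
    "f \<ominus>\<^bsub>Hom C X Y\<^esub> g = zero_mor X Y \<longleftrightarrow> f = g"
proof -
  have XY: "X \<in> Obj C" "Y \<in> Obj C" using assms by auto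
  interpret module K "Hom C X Y" using hom_module XY .
  have fg: "f \<in> Mor C X Y" "g \<in> Mor C X Y" using assms XY mor_iff by auto
  then have "f \<ominus>\<^bsub>Hom C X Y\<^esub> g \<in> Mor C X Y" by simp
  then show "arr (f \<ominus>\<^bsub>Hom C X Y\<^esub> g)" "src (f \<ominus>\<^bsub>Hom C X Y\<^esub> g) = X" "tgt (f \<ominus>\<^bsub>Hom C X Y\<^esub> g) = Y"
    using mor_iff XY by auto
  show "f \<ominus>\<^bsub>Hom C X Y\<^esub> g = zero_mor X Y \<longleftrightarrow> f = g" using fg by (rule minus_eq_zero_iff)
qed

lemma zero_object_iff:
  "zero_object C Z \<longleftrightarrow> Z \<in> Obj C \<and> Ident C Z = zero_mor Z Z"
proof
  assume z: "zero_object C Z"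
  then have Z: "Z \<in> Obj C" unfolding zero_object_def by simp
  then have "\<exists>!f. f \<in> Mor C Z Z" using z unfolding zero_object_def by blast
  then show "Z \<in> Obj C \<and> Ident C Z = zero_mor Z Z"
    using Z mor_iff[OF Z Z] ident_arr[OF Z] zero_arr[OF Z Z] by metis
next
  assume *: "Z \<in> Obj C \<and> Ident C Z = zero_mor Z Z"
  then have Z: "Z \<in> Obj C" and e: "Ident C Z = zero_mor Z Z" by auto
  have "f = zero_mor X Z" if "X \<in> Obj C" "f \<in> Mor C X Z" for X f
    using comp_ident_left[of f Z] comp_zero_left[of f Z Z] that Z mor_iff e by auto
  moreover have "f = zero_mor Z X" if "X \<in> Obj C" "f \<in> Mor C Z X" for X f
    using comp_ident_right[of f Z] comp_zero_right[of f Z Z] that Z mor_iff e by auto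
  ultimately show "zero_object C Z"
    unfolding zero_object_def using Z mor_iff zero_arr by (metis (no_types, lifting))
qed

lemma to_zero_object: "\<lbrakk>zero_object C Z; arr f; tgt f = Z\<rbrakk> \<Longrightarrow> f = zero_mor (src f) Z"
  using comp_ident_left[of f Z] comp_zero_left[of f Z Z] unfolding zero_object_iff by metis

lemma from_zero_object: "\<lbrakk>zero_object C Z; arr f; src f = Z\<rbrakk> \<Longrightarrow> f = zero_mor Z (tgt f)"
  using comp_ident_right[of f Z] comp_zero_right[of f Z Z] unfolding zero_object_iff by metis

lemma monicD:
  assumes "monic C X Y f"
  shows "arr f" "src f = X" "tgt f = Y" "X \<in> Obj C" "Y \<in> Obj C"
    and "\<And>g h. \<lbrakk>arr g; arr h; tgt g = X; tgt h = X; src g = src h; f \<cdot> g = f \<cdot> h\<rbrakk> \<Longrightarrow> g = h"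
proof -
  show XY: "X \<in> Obj C" "Y \<in> Obj C" using assms unfolding monic_def by auto
  then show "arr f" "src f = X" "tgt f = Y" using assms mor_iff unfolding monic_def by auto
  show "g = h" if "arr g" "arr h" "tgt g = X" "tgt h = X" "src g = src h" "f \<cdot> g = f \<cdot> h" for g h
    using assms that arr_mor[of g] arr_mor[of h] src_tgt_obj(1)[of g] unfolding monic_def
    by (metis (no_types, lifting))
qed

lemma epicD:
  assumes "epic C X Y f"
  shows "arr f" "src f = X" "tgt f = Y" "X \<in> Obj C" "Y \<in> Obj C"
    and "\<And>g h. \<lbrakk>arr g; arr h; src g = Y; src h = Y; tgt g = tgt h; g \<cdot> f = h \<cdot> f\<rbrakk> \<Longrightarrow> g = h"
proof -
  show XY: "X \<in> Obj C" "Y \<in> Obj C" using assms unfolding epic_def by auto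
  then show "arr f" "src f = X" "tgt f = Y" using assms mor_iff unfolding epic_def by auto
  show "g = h" if "arr g" "arr h" "src g = Y" "src h = Y" "tgt g = tgt h" "g \<cdot> f = h \<cdot> f" for g h
    using assms that arr_mor[of g] arr_mor[of h] src_tgt_obj(2)[of g] unfolding epic_def
    by (metis (no_types, lifting))
qed

lemma monicI:
  assumes "arr f" "src f = X" "tgt f = Y"
    and "\<And>g h. \<lbrakk>arr g; arr h; tgt g = X; tgt h = X; src g = src h; f \<cdot> g = f \<cdot> h\<rbrakk> \<Longrightarrow> g = h"
  shows "monic C X Y f"
proof -
  have "X \<in> Obj C" "Y \<in> Obj C" using assms by auto
  then show ?thesis unfolding monic_def using assms mor_iff by auto
qed

lemma epicI:
  assumes "arr f" "src f = X" "tgt f = Y"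
    and "\<And>g h. \<lbrakk>arr g; arr h; src g = Y; src h = Y; tgt g = tgt h; g \<cdot> f = h \<cdot> f\<rbrakk> \<Longrightarrow> g = h"
  shows "epic C X Y f"
proof -
  have "X \<in> Obj C" "Y \<in> Obj C" using assms by auto
  then show ?thesis unfolding epic_def using assms mor_iff by auto
qed

lemma monicI_zero:
  assumes f: "arr f" "src f = X" "tgt f = Y"
    and z: "\<And>g. \<lbrakk>arr g; tgt g = X; f \<cdot> g = zero_mor (src g) Y\<rbrakk> \<Longrightarrow> g = zero_mor (src g) X"
  shows "monic C X Y f"
proof (rule monicI[OF f])
  fix g h assume gh: "arr g" "arr h" "tgt g = X" "tgt h = X" "src g = src h" "f \<cdot> g = f \<cdot> h"
  let ?d = "g \<ominus>\<^bsub>Hom C (src g) X\<^esub> h"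
  note d = minus_arr[of g h "src g" X, OF gh(1,2) refl gh(5)[symmetric] gh(3,4)]
  have "f \<cdot> ?d = f \<cdot> g \<ominus>\<^bsub>Hom C (src g) Y\<^esub> f \<cdot> h"
    by (rule comp_minus_right) (use gh f arr_mor[of g] arr_mor[of h] arr_mor[of f] in auto)
  also have "\<dots> = zero_mor (src g) Y"
    using gh f minus_arr(4)[of "f \<cdot> g" "f \<cdot> h" "src g" Y] by simp
  finally show "g = h" using z[of ?d] d by simp
qed

lemma projectiveD:
  assumes "projective C P" "epic C X Y e" "arr f" "src f = P" "tgt f = Y"
  obtains g where "arr g" "src g = P" "tgt g = X" "e \<cdot> g = f"
proof -
  note e = epicD[OF assms(2)]
  have P: "P \<in> Obj C" using assms(1) unfolding projective_def by blast
  then have "f \<in> Mor C P Y" using e assms mor_iff by auto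
  then obtain g where "g \<in> Mor C P X" "e \<cdot> g = f"
    using assms(1,2) unfolding projective_def by blast
  then show thesis using that mor_iff[OF P e(4)] by auto
qed

lemma projectiveI:
  assumes "P \<in> Obj C"
    and "\<And>X Y e f. \<lbrakk>epic C X Y e; arr f; src f = P; tgt f = Y\<rbrakk>
      \<Longrightarrow> \<exists>g. arr g \<and> src g = P \<and> tgt g = X \<and> e \<cdot> g = f"
  shows "projective C P"
  unfolding projective_def
proof (intro conjI allI impI ballI)
  fix X Y e f assume e: "epic C X Y e" and f: "f \<in> Mor C P Y"
  note e' = epicD[OF e]
  show "\<exists>g\<in>Mor C P X. e \<cdot> g = f"
    using assms(2)[OF e, of f] f mor_iff assms(1) e'(4,5) by (metis (no_types, lifting))
qed fact

lemma injectiveD: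
  assumes "injective C I" "monic C X Y m" "arr f" "src f = X" "tgt f = I"
  obtains g where "arr g" "src g = Y" "tgt g = I" "g \<cdot> m = f"
proof -
  note m = monicD[OF assms(2)]
  have I: "I \<in> Obj C" using assms(1) unfolding injective_def by blast
  then have "f \<in> Mor C X I" using m assms mor_iff by auto
  then obtain g where "g \<in> Mor C Y I" "g \<cdot> m = f"
    using assms(1,2) unfolding injective_def by blast
  then show thesis using that mor_iff[OF m(5) I] by auto
qed

lemma injectiveI:
  assumes "I \<in> Obj C"
    and "\<And>X Y m f. \<lbrakk>monic C X Y m; arr f; src f = X; tgt f = I\<rbrakk>
      \<Longrightarrow> \<exists>g. arr g \<and> src g = Y \<and> tgt g = I \<and> g \<cdot> m = f"
  shows "injective C I"
  unfolding injective_def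
proof (intro conjI allI impI ballI)
  fix X Y m f assume m: "monic C X Y m" and f: "f \<in> Mor C X I"
  note m' = monicD[OF m]
  show "\<exists>g\<in>Mor C Y I. g \<cdot> m = f"
    using assms(2)[OF m, of f] f mor_iff assms(1) m'(4,5) by (metis (no_types, lifting))
qed fact

lemma projective_retract:
  assumes P: "projective C P" and e: "arr e" "src e = R" "tgt e = P" and r: "arr r" "src r = P" "tgt r = R"
    and re: "r \<cdot> e = Ident C R"
  shows "projective C R"
proof (rule projectiveI)
  show R: "R \<in> Obj C" using e by auto
  fix X Y q f assume q: "epic C X Y q" and f: "arr f" "src f = R" "tgt f = Y"
  obtain g where g: "arr g" "src g = P" "tgt g = X" "q \<cdot> g = f \<cdot> r"
    using projectiveD[OF P q, of "f \<cdot> r"] f r by auto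
  have "q \<cdot> (g \<cdot> e) = (f \<cdot> r) \<cdot> e"
    using g e epicD(1-3)[OF q] comp_assoc_arr[of q g e] by (simp del: comp_assoc_arr)
  also have "\<dots> = f" using g f r e re by simp
  finally show "\<exists>g. arr g \<and> src g = R \<and> tgt g = X \<and> q \<cdot> g = f"
    using g e by (intro exI[of _ "g \<cdot> e"]) auto
qed

lemma is_kernelD:
  assumes "is_kernel C X Y f N k"
  shows "arr k" "src k = N" "tgt k = X" "f \<cdot> k = zero_mor N Y" "monic C N X k"
    and "\<And>h. \<lbrakk>arr h; tgt h = X; f \<cdot> h = zero_mor (src h) Y\<rbrakk>
      \<Longrightarrow> \<exists>u. arr u \<and> src u = src h \<and> tgt u = N \<and> k \<cdot> u = h"
proof -
  have o: "X \<in> Obj C" "Y \<in> Obj C" "N \<in> Obj C" and f: "f \<in> Mor C X Y"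
    using assms unfolding is_kernel_def by auto
  have f': "arr f" "src f = X" "tgt f = Y" using f mor_iff o by auto
  show k: "arr k" "src k = N" "tgt k = X" and fk: "f \<cdot> k = zero_mor N Y"
    using assms mor_iff o unfolding is_kernel_def by auto
  have u: "\<exists>!u. u \<in> Mor C (src h) N \<and> k \<cdot> u = h"
    if "arr h" "tgt h = X" "f \<cdot> h = zero_mor (src h) Y" for h
    using assms that arr_mor[of h] unfolding is_kernel_def by auto
  show "\<exists>u. arr u \<and> src u = src h \<and> tgt u = N \<and> k \<cdot> u = h"
    if h: "arr h" "tgt h = X" "f \<cdot> h = zero_mor (src h) Y" for h
    using u[OF h] mor_iff[OF src_tgt_obj(1)[OF h(1)] o(3)] by auto
  show "monic C N X k"
  proof (rule monicI[OF k])
    fix g h assume gh: "arr g" "arr h" "tgt g = N" "tgt h = N" "src g = src h" "k \<cdot> g = k \<cdot> h"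
    have "f \<cdot> (k \<cdot> g) = (f \<cdot> k) \<cdot> g" using f' k gh by simp
    also have "\<dots> = zero_mor (src g) Y" using fk gh o by simp
    finally have "\<exists>!u. u \<in> Mor C (src g) N \<and> k \<cdot> u = k \<cdot> g"
      using u[of "k \<cdot> g"] gh k by simp
    then show "g = h" using gh arr_mor[of g] arr_mor[of h] by (metis (no_types, lifting))
  qed
qed

lemma comp_smult_right:
  assumes "a \<in> carrier K" "arr f" "arr g" "src f = X" "tgt f = Y" "src g = Y" "tgt g = Z"
  shows "g \<cdot> (a \<odot>\<^bsub>Hom C X Y\<^esub> f) = a \<odot>\<^bsub>Hom C X Z\<^esub> (g \<cdot> f)"
  using assms linear_mapD(3)[OF comp_linear_right[of X Y Z g]] arr_mor[of f] arr_mor[of g] by auto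

lemma is_cokernelD:
  assumes "is_cokernel C X Y f Q c"
  shows "arr c" "src c = Y" "tgt c = Q" "X \<in> Obj C" "Y \<in> Obj C" "Q \<in> Obj C" "arr f" "src f = X" "tgt f = Y"
    "\<And>Z h. \<lbrakk>arr h; src h = Y; tgt h = Z; h \<cdot> f = zero_mor X Z\<rbrakk>
      \<Longrightarrow> \<exists>!u. (arr u \<and> src u = Q \<and> tgt u = Z) \<and> u \<cdot> c = h"
proof -
  show o: "X \<in> Obj C" "Y \<in> Obj C" "Q \<in> Obj C" using assms unfolding is_cokernel_def by auto
  then show "arr c" "src c = Y" "tgt c = Q" "arr f" "src f = X" "tgt f = Y"
    using assms mor_iff unfolding is_cokernel_def by auto
  show "\<exists>!u. (arr u \<and> src u = Q \<and> tgt u = Z) \<and> u \<cdot> c = h"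
    if h: "arr h" "src h = Y" "tgt h = Z" "h \<cdot> f = zero_mor X Z" for Z h
  proof -
    have Z: "Z \<in> Obj C" "h \<in> Mor C Y Z" using h arr_mor[of h] by auto
    then have "\<exists>!u. u \<in> Mor C Q Z \<and> u \<cdot> c = h"
      using assms h(4) unfolding is_cokernel_def by blast
    then show ?thesis using mor_iff[OF o(3) Z(1)] by simp
  qed
qed

lemma linear_category_full_subcategory:
  assumes "S \<subseteq> Obj C"
  shows "linear_category K (full_subcategory C S)"
proof (rule linear_category.intro, goal_cases)
  case (1 X Y)
  then show ?case using hom_module[of X Y] by (simp add: full_subcategory_def subsetD[OF assms])
next
  case (2 X Y X' Y' f)
  then show ?case using hom_disjoint[of X Y X' Y' f] by (simp add: full_subcategory_def subsetD[OF assms])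
next
  case (3 X)
  then show ?case using ident_in_hom[of X] by (simp add: full_subcategory_def subsetD[OF assms])
next
  case (4 X Y Z g f)
  then show ?case using comp_in_hom[of X Y Z g f] by (simp add: full_subcategory_def subsetD[OF assms])
next
  case (5 X Y f)
  then show ?case using comp_ident[of X Y f] by (simp add: full_subcategory_def subsetD[OF assms])
next
  case (6 W X Y Z h g f)
  then show ?case using comp_assoc[of W X Y Z h g f] by (simp add: full_subcategory_def subsetD[OF assms])
next
  case (7 X Y Z f)
  then show ?case using comp_linear_left[of X Y Z f] by (simp add: full_subcategory_def subsetD[OF assms])
next
  case (8 X Y Z g)
  then show ?case using comp_linear_right[of X Y Z g] by (simp add: full_subcategory_def subsetD[OF assms])
qed

lemma proj_simps [simp]:
  "Obj (Proj C) = {P. projective C P}" "Hom (Proj C) = Hom C" "Ident (Proj C) = Ident C"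
  "Comp (Proj C) = Comp C"
  unfolding Proj_def full_subcategory_def by simp_all

lemma projective_obj: "projective C X \<Longrightarrow> X \<in> Obj C"
  unfolding projective_def by blast

lemma proj_linear_category: "linear_category K (Proj C)"
proof -
  have "linear_category K (full_subcategory C {P. projective C P})"
    by (rule linear_category_full_subcategory) (auto dest: projective_obj)
  then show ?thesis unfolding Proj_def .
qed

end

context abelian_category
begin

lemma kernelE:
  assumes "arr f"
  obtains N k where "is_kernel C (src f) (tgt f) f N k"
  using kernel_exists arr_mor[OF assms] assms by (metis src_tgt_obj)

lemma iso_morD:
  assumes "iso_mor C X Y f"
  obtains g where "arr g" "src g = Y" "tgt g = X" "g \<cdot> f = Ident C X" "f \<cdot> g = Ident C Y"
    "arr f" "src f = X" "tgt f = Y" "X \<in> Obj C" "Y \<in> Obj C"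
  using assms mor_iff unfolding iso_mor_def by auto

lemma iso_morI:
  assumes "arr f" "src f = X" "tgt f = Y" "arr g" "src g = Y" "tgt g = X"
    "g \<cdot> f = Ident C X" "f \<cdot> g = Ident C Y"
  shows "iso_mor C X Y f"
proof -
  have "X \<in> Obj C" "Y \<in> Obj C" using assms by auto
  then show ?thesis unfolding iso_mor_def using assms mor_iff by auto
qed

lemma simple_objectD:
  assumes "simple_object C S"
  shows "S \<in> Obj C" "\<not> zero_object C S"
    "\<And>X f. monic C X S f \<Longrightarrow> zero_object C X \<or> iso_mor C X S f"
  using assms unfolding simple_object_def by auto

text \<open>If \<open>d m = 0\<close>, then \<open>m\<close> factors through the kernel of \<open>d\<close>, a subobject of \<open>S\<close> that is therefore
  nonzero, hence all of \<open>S\<close>.\<close>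

lemma to_simple_epic:
  assumes S: "simple_object C S" and m: "arr m" "tgt m = S" "m \<noteq> zero_mor (src m) S"
  shows "epic C (src m) S m"
proof (rule epicI)
  fix g h assume gh: "arr g" "arr h" "src g = S" "src h = S" "tgt g = tgt h" "g \<cdot> m = h \<cdot> m"
  let ?d = "g \<ominus>\<^bsub>Hom C S (tgt g)\<^esub> h"
  note d = minus_arr[of g h S "tgt g", OF gh(1,2,3,4) refl gh(5)[symmetric]]
  have "?d \<cdot> m = g \<cdot> m \<ominus>\<^bsub>Hom C (src m) (tgt g)\<^esub> h \<cdot> m"
    by (rule comp_minus_left) (use gh m arr_mor[of g] arr_mor[of h] arr_mor[of m] in auto)
  also have "\<dots> = zero_mor (src m) (tgt g)"
    using gh m minus_arr(4)[of "g \<cdot> m" "h \<cdot> m" "src m" "tgt g"] by simp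
  finally have dm: "?d \<cdot> m = zero_mor (src m) (tgt g)" .
  obtain N k where k: "is_kernel C S (tgt g) ?d N k" using kernelE[OF d(1)] unfolding d(2,3) .
  note k' = is_kernelD[OF k]
  obtain u where u: "arr u" "src u = src m" "tgt u = N" "k \<cdot> u = m"
    using k'(6)[of m] m dm by auto
  have "\<not> zero_object C N"
  proof
    assume "zero_object C N"
    then have "u = zero_mor (src m) N" using to_zero_object[of N u] u by simp
    then have "m = zero_mor (src m) S" using u k' m by (metis comp_zero_right src_tgt_obj(1))
    then show False using m(3) by contradiction
  qed
  then have "iso_mor C N S k" using simple_objectD(3)[OF S k'(5)] by simp
  then obtain k2 where k2: "arr k2" "src k2 = S" "tgt k2 = N" "k \<cdot> k2 = Ident C S"
    by (rule iso_morD)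
  have "?d = ?d \<cdot> (k \<cdot> k2)" using d(1,2) k2(4) by simp
  also have "\<dots> = (?d \<cdot> k) \<cdot> k2" using d(1,2) k2 k'(1-3) by simp
  also have "\<dots> = zero_mor S (tgt g)" using k'(4) k2 gh(1) by simp
  finally show "g = h" using d(4) by simp
qed (use m in auto)

lemma from_simple_monic:
  assumes S: "simple_object C S" and m: "arr m" "src m = S" "m \<noteq> zero_mor S (tgt m)"
  shows "monic C S (tgt m) m"
proof -
  obtain N k where k: "is_kernel C S (tgt m) m N k" using kernelE[of m] m by auto
  note k' = is_kernelD[OF k]
  have "\<not> iso_mor C N S k"
  proof
    assume "iso_mor C N S k"
    then obtain k2 where k2: "arr k2" "src k2 = S" "tgt k2 = N" "k \<cdot> k2 = Ident C S"
      by (rule iso_morD)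
    have "m = m \<cdot> (k \<cdot> k2)" using m k2(4) by simp
    also have "\<dots> = (m \<cdot> k) \<cdot> k2" using m(1,2) k2(1,3) k'(1-3) by simp
    also have "\<dots> = zero_mor S (tgt m)" using k'(4) k2 m by simp
    finally show False using m(3) by contradiction
  qed
  then have N: "zero_object C N" using simple_objectD(3)[OF S k'(5)] by simp
  show ?thesis
  proof (rule monicI_zero)
    fix g assume g: "arr g" "tgt g = S" "m \<cdot> g = zero_mor (src g) (tgt m)"
    then obtain u where u: "arr u" "src u = src g" "tgt u = N" "k \<cdot> u = g" using k'(6) by auto
    then have "u = zero_mor (src g) N" using to_zero_object[OF N, of u] by simp
    then show "g = zero_mor (src g) S" using u k' g by (metis comp_zero_right src_tgt_obj(1))
  qed (use m in auto)
qed

lemma monic_epic_iso: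
  assumes m: "monic C X Y f" and e: "epic C X Y f"
  shows "iso_mor C X Y f"
proof -
  note m' = monicD[OF m] and e' = epicD[OF e]
  obtain Z g where "is_cokernel C Z X g Y f" using epic_is_cokernel[OF e] by blast
  then have o: "Z \<in> Obj C" and g: "g \<in> Mor C Z X" and fg: "f \<cdot> g = zero_mor Z Y"
    and univ: "\<And>h. \<lbrakk>h \<in> Mor C X X; h \<cdot> g = zero_mor Z X\<rbrakk> \<Longrightarrow> \<exists>!u. u \<in> Mor C Y X \<and> u \<cdot> f = h"
    using m' unfolding is_cokernel_def by auto
  have g': "arr g" "src g = Z" "tgt g = X" using g mor_iff o m'(4) by auto
  have "g = zero_mor Z X" using m'(6)[of g "zero_mor Z X"] g' fg m' o by simp
  then obtain u where u: "u \<in> Mor C Y X" "u \<cdot> f = Ident C X"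
    using univ[of "Ident C X"] ident_in_hom[OF m'(4)] m'(4) o by auto
  have u': "arr u" "src u = Y" "tgt u = X" using u mor_iff m' by auto
  have "(f \<cdot> u) \<cdot> f = Ident C Y \<cdot> f" using u u' m' by simp
  then have "f \<cdot> u = Ident C Y" using e'(6)[of "f \<cdot> u" "Ident C Y"] u' m' by simp
  then show ?thesis using u u' m' by (intro iso_morI) auto
qed

lemma monic_comp:
  assumes f: "monic C X Y f" and g: "monic C Y Z g"
  shows "monic C X Z (g \<cdot> f)"
proof -
  note f' = monicD[OF f] and g' = monicD[OF g]
  show ?thesis
  proof (rule monicI)
    fix u v assume uv: "arr u" "arr v" "tgt u = X" "tgt v = X" "src u = src v" "(g \<cdot> f) \<cdot> u = (g \<cdot> f) \<cdot> v"
    then have "f \<cdot> u = f \<cdot> v"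
      using g'(6)[of "f \<cdot> u" "f \<cdot> v"] f'(1-3) g'(1-3) by simp
    then show "u = v" using f'(6) uv by simp
  qed (use f'(1-3) g'(1-3) in simp_all)
qed

text \<open>The first nonzero term of a composition series is isomorphic to its simple factor.\<close>

lemma simple_subobject_exists:
  assumes fin: "finite_length_object C X" and nz: "\<not> zero_object C X"
  obtains S j where "simple_object C S" "monic C S X j"
proof -
  obtain n Y i S p where Y0: "zero_object C (Y 0)" and Yn: "Y n = X"
    and st: "\<And>j. j < n \<Longrightarrow> monic C (Y j) (Y (Suc j)) (i j) \<and>
        is_cokernel C (Y j) (Y (Suc j)) (i j) (S j) (p j) \<and> simple_object C (S j)"
    using fin unfolding finite_length_object_def by (elim exE conjE) blast
  have "zero_object C (Y k) \<or> (\<exists>T j. simple_object C T \<and> monic C T (Y k) j)" if "k \<le> n" for k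
    using that
  proof (induction k)
    case 0
    then show ?case using Y0 by simp
  next
    case (Suc k)
    then have mi: "monic C (Y k) (Y (Suc k)) (i k)"
      and ck: "is_cokernel C (Y k) (Y (Suc k)) (i k) (S k) (p k)" and sk: "simple_object C (S k)"
      using st[of k] by auto
    have "zero_object C (Y k) \<or> (\<exists>T j. simple_object C T \<and> monic C T (Y k) j)" using Suc by simp
    then show ?case
    proof (elim disjE exE conjE)
      fix T j assume "simple_object C T" "monic C T (Y k) j"
      then show ?thesis using monic_comp[OF _ mi] by blast
    next
      assume z: "zero_object C (Y k)"
      note c = is_cokernelD[OF ck]
      have i0: "i k = zero_mor (Y k) (Y (Suc k))" using from_zero_object[OF z c(7,8)] c(9) by simp
      obtain u where u: "arr u" "src u = S k" "tgt u = Y (Suc k)" "u \<cdot> p k = Ident C (Y (Suc k))"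
        using c(10)[of "Ident C (Y (Suc k))" "Y (Suc k)"] c(4,5) i0 by auto
      have "\<exists>!w. (arr w \<and> src w = S k \<and> tgt w = S k) \<and> w \<cdot> p k = p k"
        using c(10)[OF c(1-3)] c(1-6) i0 by simp
      moreover have "(p k \<cdot> u) \<cdot> p k = p k" using u c(1-3) by simp
      moreover have "Ident C (S k) \<cdot> p k = p k" using c(1-3) by simp
      ultimately have pu: "p k \<cdot> u = Ident C (S k)"
        using u(1-3) c(1-3,6) by (metis comp_arr ident_arr)
      have "monic C (S k) (Y (Suc k)) u"
      proof (rule monicI[OF u(1-3)])
        fix g h assume gh: "arr g" "arr h" "tgt g = S k" "tgt h = S k" "u \<cdot> g = u \<cdot> h"
        have "(p k \<cdot> u) \<cdot> g = (p k \<cdot> u) \<cdot> h" using gh u(1-3) c(1-3) by simp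
        then show "g = h" using gh pu by simp
      qed
      then show ?thesis using sk by blast
    qed
  qed
  then show thesis using that Yn nz by blast
qed

end

section \<open>Duality in tensor categories\<close>

context tensor_category
begin

declare unit_in_obj [simp] tensor_in_obj [simp]

lemma tensor_arr [simp]:
  assumes "arr f" "arr g"
  shows "arr (f \<boxdot> g)" "src (f \<boxdot> g) = src f \<boxtimes> src g" "tgt (f \<boxdot> g) = tgt f \<boxtimes> tgt g"
  using tensor_in_hom[OF _ _ _ _ arr_mor arr_mor, of f g] assms mor_iff by auto

lemma tensor_obj_simps [simp]:
  "\<lbrakk>X \<in> Obj C; Y \<in> Obj C; Z \<in> Obj C\<rbrakk> \<Longrightarrow> (X \<boxtimes> Y) \<boxtimes> Z = X \<boxtimes> (Y \<boxtimes> Z)"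
  "X \<in> Obj C \<Longrightarrow> Unit C \<boxtimes> X = X"
  "X \<in> Obj C \<Longrightarrow> X \<boxtimes> Unit C = X"
  using tensor_assoc_obj tensor_unit_obj by auto

lemma tensor_mor_assoc [simp]:
  "\<lbrakk>arr f; arr g; arr h\<rbrakk> \<Longrightarrow> (f \<boxdot> g) \<boxdot> h = f \<boxdot> (g \<boxdot> h)"
  using tensor_assoc_mor[OF _ _ _ _ _ _ arr_mor arr_mor arr_mor, of f g h] by simp

lemma tensor_mor_unit [simp]:
  "arr f \<Longrightarrow> Ident C (Unit C) \<boxdot> f = f" "arr f \<Longrightarrow> f \<boxdot> Ident C (Unit C) = f"
  using tensor_unit_mor[OF _ _ arr_mor, of f] by auto

lemma tensor_ident_fold [simp]:
  "\<lbrakk>X \<in> Obj C; Y \<in> Obj C\<rbrakk> \<Longrightarrow> Ident C X \<boxdot> Ident C Y = Ident C (X \<boxtimes> Y)"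
  "\<lbrakk>X \<in> Obj C; Y \<in> Obj C; arr f\<rbrakk> \<Longrightarrow> Ident C X \<boxdot> (Ident C Y \<boxdot> f) = Ident C (X \<boxtimes> Y) \<boxdot> f"
  using tensor_ident tensor_mor_assoc[of "Ident C X" "Ident C Y" f] by auto

lemma interchange:
  "\<lbrakk>arr f; arr g; arr f'; arr g'; src g = tgt f; src g' = tgt f'\<rbrakk>
    \<Longrightarrow> (g \<boxdot> g') \<cdot> (f \<boxdot> f') = (g \<cdot> f) \<boxdot> (g' \<cdot> f')"
  using tensor_comp[of "src f" "tgt f" "tgt g" "src f'" "tgt f'" "tgt g'" f g f' g']
    arr_mor[of f] arr_mor[of g] arr_mor[of f'] arr_mor[of g'] by simp

lemma whisker_right_comp:
  "\<lbrakk>arr f; arr g; src g = tgt f; Z \<in> Obj C\<rbrakk>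
    \<Longrightarrow> (g \<cdot> f) \<boxdot> Ident C Z = (g \<boxdot> Ident C Z) \<cdot> (f \<boxdot> Ident C Z)"
  using interchange[of f g "Ident C Z" "Ident C Z"] by simp

lemma whisker_left_comp:
  "\<lbrakk>arr f; arr g; src g = tgt f; Z \<in> Obj C\<rbrakk>
    \<Longrightarrow> Ident C Z \<boxdot> (g \<cdot> f) = (Ident C Z \<boxdot> g) \<cdot> (Ident C Z \<boxdot> f)"
  using interchange[of "Ident C Z" "Ident C Z" f g] by simp

lemma slide:
  assumes "arr f" "arr g" "src f = X" "tgt f = Y" "src g = Z" "tgt g = W"
  shows "(Ident C Y \<boxdot> g) \<cdot> (f \<boxdot> Ident C Z) = (f \<boxdot> Ident C W) \<cdot> (Ident C X \<boxdot> g)"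
  using assms interchange[of f "Ident C Y" "Ident C Z" g] interchange[of "Ident C X" f g "Ident C W"]
  by auto

lemma tensor_zero [simp]:
  assumes "arr f" "X \<in> Obj C" "Y \<in> Obj C"
  shows "zero_mor X Y \<boxdot> f = zero_mor (X \<boxtimes> src f) (Y \<boxtimes> tgt f)"
proof -
  have o: "src f \<in> Obj C" "tgt f \<in> Obj C" using assms by auto
  show "zero_mor X Y \<boxdot> f = zero_mor (X \<boxtimes> src f) (Y \<boxtimes> tgt f)"
    by (rule linear_map_zero[OF _ _ tensor_linear_left[of X Y "src f" "tgt f" f]])
      (use assms o arr_mor[of f] in \<open>auto intro!: hom_module\<close>)
qed

text \<open>The object \<open>B\<close> is a left dual of \<open>A\<close>. In a pivotal category both \<open>(V, V*)\<close> and
  \<open>(V*, V)\<close> are such pairs, so that every consequence of this definition holds on either side.\<close>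

definition dual_pair :: "'o \<Rightarrow> 'o \<Rightarrow> 'm \<Rightarrow> 'm \<Rightarrow> bool"
  where "dual_pair A B ev co \<longleftrightarrow> A \<in> Obj C \<and> B \<in> Obj C \<and>
    arr ev \<and> src ev = B \<boxtimes> A \<and> tgt ev = Unit C \<and> arr co \<and> src co = Unit C \<and> tgt co = A \<boxtimes> B \<and>
    (Ident C A \<boxdot> ev) \<cdot> (co \<boxdot> Ident C A) = Ident C A \<and>
    (ev \<boxdot> Ident C B) \<cdot> (Ident C B \<boxdot> co) = Ident C B"

context
  fixes A B ev co
  assumes dp: "dual_pair A B ev co"
begin

lemma dual_pairD [simp]:
  "A \<in> Obj C" "B \<in> Obj C" "arr ev" "src ev = B \<boxtimes> A" "tgt ev = Unit C"
  "arr co" "src co = Unit C" "tgt co = A \<boxtimes> B"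
  and zigzag: "(Ident C A \<boxdot> ev) \<cdot> (co \<boxdot> Ident C A) = Ident C A"
    "(ev \<boxdot> Ident C B) \<cdot> (Ident C B \<boxdot> co) = Ident C B"
  using dp unfolding dual_pair_def by auto

text \<open>The functor \<open>X \<mapsto> X A\<close> is left adjoint to \<open>X \<mapsto> X B\<close>, and \<open>X \<mapsto> B X\<close> is left adjoint to
  \<open>X \<mapsto> A X\<close>. The next four lemmas say that transposition in either adjunction is bijective; each
  is an exchange of independent factors followed by a zigzag identity.\<close>

lemma right_transpose_inverse1:
  assumes v: "arr v" "src v = X \<boxtimes> A" "tgt v = Y" and X: "X \<in> Obj C"
  shows "(Ident C Y \<boxdot> ev) \<cdot> (((v \<boxdot> Ident C B) \<cdot> (Ident C X \<boxdot> co)) \<boxdot> Ident C A) = v"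
proof -
  have Y: "Y \<in> Obj C" using v by auto
  have "((v \<boxdot> Ident C B) \<cdot> (Ident C X \<boxdot> co)) \<boxdot> Ident C A
      = (v \<boxdot> Ident C (B \<boxtimes> A)) \<cdot> (Ident C X \<boxdot> co \<boxdot> Ident C A)"
    using v X by (simp add: whisker_right_comp)
  then have "(Ident C Y \<boxdot> ev) \<cdot> (((v \<boxdot> Ident C B) \<cdot> (Ident C X \<boxdot> co)) \<boxdot> Ident C A)
      = ((Ident C Y \<boxdot> ev) \<cdot> (v \<boxdot> Ident C (B \<boxtimes> A))) \<cdot> (Ident C X \<boxdot> co \<boxdot> Ident C A)"
    using v X Y by simp
  also have "(Ident C Y \<boxdot> ev) \<cdot> (v \<boxdot> Ident C (B \<boxtimes> A)) = v \<cdot> (Ident C X \<boxdot> Ident C A \<boxdot> ev)"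
    using slide[of v ev, OF v(1) dual_pairD(3) refl refl refl refl] v X by simp
  also have "(v \<cdot> (Ident C X \<boxdot> Ident C A \<boxdot> ev)) \<cdot> (Ident C X \<boxdot> co \<boxdot> Ident C A)
      = v \<cdot> ((Ident C X \<boxdot> Ident C A \<boxdot> ev) \<cdot> (Ident C X \<boxdot> co \<boxdot> Ident C A))"
    using v X by simp
  also have "(Ident C X \<boxdot> Ident C A \<boxdot> ev) \<cdot> (Ident C X \<boxdot> co \<boxdot> Ident C A) = Ident C (X \<boxtimes> A)"
    using whisker_left_comp[of "co \<boxdot> Ident C A" "Ident C A \<boxdot> ev" X] X zigzag by simp
  finally show ?thesis using v X by simp
qed

lemma right_transpose_inverse2:
  assumes u: "arr u" "src u = X" "tgt u = Y \<boxtimes> B" and Y: "Y \<in> Obj C"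
  shows "(((Ident C Y \<boxdot> ev) \<cdot> (u \<boxdot> Ident C A)) \<boxdot> Ident C B) \<cdot> (Ident C X \<boxdot> co) = u"
proof -
  have X: "X \<in> Obj C" using u by auto
  have "((Ident C Y \<boxdot> ev) \<cdot> (u \<boxdot> Ident C A)) \<boxdot> Ident C B
      = (Ident C Y \<boxdot> ev \<boxdot> Ident C B) \<cdot> (u \<boxdot> Ident C (A \<boxtimes> B))"
    using u Y by (simp add: whisker_right_comp)
  then have "(((Ident C Y \<boxdot> ev) \<cdot> (u \<boxdot> Ident C A)) \<boxdot> Ident C B) \<cdot> (Ident C X \<boxdot> co)
      = (Ident C Y \<boxdot> ev \<boxdot> Ident C B) \<cdot> ((u \<boxdot> Ident C (A \<boxtimes> B)) \<cdot> (Ident C X \<boxdot> co))"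
    using u X Y by simp
  also have "(u \<boxdot> Ident C (A \<boxtimes> B)) \<cdot> (Ident C X \<boxdot> co) = (Ident C Y \<boxdot> Ident C B \<boxdot> co) \<cdot> u"
    using slide[of u co, OF u(1) dual_pairD(6) refl refl refl refl] u Y by simp
  also have "(Ident C Y \<boxdot> ev \<boxdot> Ident C B) \<cdot> ((Ident C Y \<boxdot> Ident C B \<boxdot> co) \<cdot> u)
      = ((Ident C Y \<boxdot> ev \<boxdot> Ident C B) \<cdot> (Ident C Y \<boxdot> Ident C B \<boxdot> co)) \<cdot> u"
    using u Y by simp
  also have "(Ident C Y \<boxdot> ev \<boxdot> Ident C B) \<cdot> (Ident C Y \<boxdot> Ident C B \<boxdot> co) = Ident C (Y \<boxtimes> B)"
    using whisker_left_comp[of "Ident C B \<boxdot> co" "ev \<boxdot> Ident C B" Y] Y zigzag by simp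
  finally show ?thesis using u Y by simp
qed

lemma left_transpose_inverse1:
  assumes v: "arr v" "src v = B \<boxtimes> X" "tgt v = Y" and X: "X \<in> Obj C"
  shows "(ev \<boxdot> Ident C Y) \<cdot> (Ident C B \<boxdot> ((Ident C A \<boxdot> v) \<cdot> (co \<boxdot> Ident C X))) = v"
proof -
  have Y: "Y \<in> Obj C" using v by auto
  have "Ident C B \<boxdot> ((Ident C A \<boxdot> v) \<cdot> (co \<boxdot> Ident C X))
      = (Ident C (B \<boxtimes> A) \<boxdot> v) \<cdot> (Ident C B \<boxdot> co \<boxdot> Ident C X)"
    using v X by (simp add: whisker_left_comp)
  then have "(ev \<boxdot> Ident C Y) \<cdot> (Ident C B \<boxdot> ((Ident C A \<boxdot> v) \<cdot> (co \<boxdot> Ident C X)))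
      = ((ev \<boxdot> Ident C Y) \<cdot> (Ident C (B \<boxtimes> A) \<boxdot> v)) \<cdot> (Ident C B \<boxdot> co \<boxdot> Ident C X)"
    using v X Y by simp
  also have "(ev \<boxdot> Ident C Y) \<cdot> (Ident C (B \<boxtimes> A) \<boxdot> v) = v \<cdot> (ev \<boxdot> Ident C (B \<boxtimes> X))"
    using slide[of ev v, OF dual_pairD(3) v(1) refl refl refl refl] v X by simp
  also have "(v \<cdot> (ev \<boxdot> Ident C (B \<boxtimes> X))) \<cdot> (Ident C B \<boxdot> co \<boxdot> Ident C X)
      = v \<cdot> ((ev \<boxdot> Ident C (B \<boxtimes> X)) \<cdot> (Ident C B \<boxdot> co \<boxdot> Ident C X))"
    using v X by simp
  also have "(ev \<boxdot> Ident C (B \<boxtimes> X)) \<cdot> (Ident C B \<boxdot> co \<boxdot> Ident C X) = Ident C (B \<boxtimes> X)"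
    using whisker_right_comp[of "Ident C B \<boxdot> co" "ev \<boxdot> Ident C B" X] X zigzag by simp
  finally show ?thesis using v X by simp
qed

lemma left_transpose_inverse2:
  assumes u: "arr u" "src u = X" "tgt u = A \<boxtimes> Y" and Y: "Y \<in> Obj C"
  shows "(Ident C A \<boxdot> ((ev \<boxdot> Ident C Y) \<cdot> (Ident C B \<boxdot> u))) \<cdot> (co \<boxdot> Ident C X) = u"
proof -
  have X: "X \<in> Obj C" using u by auto
  have "Ident C A \<boxdot> ((ev \<boxdot> Ident C Y) \<cdot> (Ident C B \<boxdot> u))
      = (Ident C A \<boxdot> ev \<boxdot> Ident C Y) \<cdot> (Ident C (A \<boxtimes> B) \<boxdot> u)"
    using u Y by (simp add: whisker_left_comp)
  then have "(Ident C A \<boxdot> ((ev \<boxdot> Ident C Y) \<cdot> (Ident C B \<boxdot> u))) \<cdot> (co \<boxdot> Ident C X)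
      = (Ident C A \<boxdot> ev \<boxdot> Ident C Y) \<cdot> ((Ident C (A \<boxtimes> B) \<boxdot> u) \<cdot> (co \<boxdot> Ident C X))"
    using u X Y by simp
  also have "(Ident C (A \<boxtimes> B) \<boxdot> u) \<cdot> (co \<boxdot> Ident C X) = (co \<boxdot> Ident C (A \<boxtimes> Y)) \<cdot> u"
    using slide[of co u, OF dual_pairD(6) u(1) refl refl refl refl] u Y by simp
  also have "(Ident C A \<boxdot> ev \<boxdot> Ident C Y) \<cdot> ((co \<boxdot> Ident C (A \<boxtimes> Y)) \<cdot> u)
      = ((Ident C A \<boxdot> ev \<boxdot> Ident C Y) \<cdot> (co \<boxdot> Ident C (A \<boxtimes> Y))) \<cdot> u"
    using u Y by simp
  also have "(Ident C A \<boxdot> ev \<boxdot> Ident C Y) \<cdot> (co \<boxdot> Ident C (A \<boxtimes> Y)) = Ident C (A \<boxtimes> Y)"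
    using whisker_right_comp[of "co \<boxdot> Ident C A" "Ident C A \<boxdot> ev" Y] Y zigzag by simp
  finally show ?thesis using u Y by simp
qed

text \<open>Transposition with \<open>X\<close> the unit object: \<open>Hom(A, Y) \<cong> Hom(1, Y B)\<close> and
  \<open>Hom(B, Y) \<cong> Hom(1, A Y)\<close>.\<close>

lemma coev_right_inj:
  assumes "arr v" "src v = A" "tgt v = Y" "arr w" "src w = A" "tgt w = Y"
    and "(v \<boxdot> Ident C B) \<cdot> co = (w \<boxdot> Ident C B) \<cdot> co"
  shows "v = w"
  using right_transpose_inverse1[of v "Unit C" Y] right_transpose_inverse1[of w "Unit C" Y] assms
  by simp

lemma coev_right_surj:
  assumes "arr u" "src u = Unit C" "tgt u = Y \<boxtimes> B" "Y \<in> Obj C"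
  obtains v where "arr v" "src v = A" "tgt v = Y" "(v \<boxdot> Ident C B) \<cdot> co = u"
proof (rule that)
  show "(((Ident C Y \<boxdot> ev) \<cdot> (u \<boxdot> Ident C A)) \<boxdot> Ident C B) \<cdot> co = u"
    using right_transpose_inverse2[of u "Unit C" Y] assms by simp
qed (use assms in simp_all)

lemma coev_left_inj:
  assumes "arr v" "src v = B" "tgt v = Y" "arr w" "src w = B" "tgt w = Y"
    and "(Ident C A \<boxdot> v) \<cdot> co = (Ident C A \<boxdot> w) \<cdot> co"
  shows "v = w"
  using left_transpose_inverse1[of v "Unit C" Y] left_transpose_inverse1[of w "Unit C" Y] assms
  by simp

lemma coev_left_surj:
  assumes "arr u" "src u = Unit C" "tgt u = A \<boxtimes> Y" "Y \<in> Obj C"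
  obtains v where "arr v" "src v = B" "tgt v = Y" "(Ident C A \<boxdot> v) \<cdot> co = u"
proof (rule that)
  show "(Ident C A \<boxdot> ((ev \<boxdot> Ident C Y) \<cdot> (Ident C B \<boxdot> u))) \<cdot> co = u"
    using left_transpose_inverse2[of u "Unit C" Y] assms by simp
qed (use assms in simp_all)

lemma right_transpose_natural:
  assumes f: "arr f" "src f = X" "tgt f = Y" and u: "arr u" "tgt u = X \<boxtimes> B"
  shows "(Ident C Y \<boxdot> ev) \<cdot> (((f \<boxdot> Ident C B) \<cdot> u) \<boxdot> Ident C A) = f \<cdot> ((Ident C X \<boxdot> ev) \<cdot> (u \<boxdot> Ident C A))"
proof -
  have o: "X \<in> Obj C" "Y \<in> Obj C" using f by auto
  have "((f \<boxdot> Ident C B) \<cdot> u) \<boxdot> Ident C A = (f \<boxdot> Ident C (B \<boxtimes> A)) \<cdot> (u \<boxdot> Ident C A)"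
    using f u o by (simp add: whisker_right_comp)
  then have "(Ident C Y \<boxdot> ev) \<cdot> (((f \<boxdot> Ident C B) \<cdot> u) \<boxdot> Ident C A)
      = ((Ident C Y \<boxdot> ev) \<cdot> (f \<boxdot> Ident C (B \<boxtimes> A))) \<cdot> (u \<boxdot> Ident C A)"
    using f u o by simp
  also have "(Ident C Y \<boxdot> ev) \<cdot> (f \<boxdot> Ident C (B \<boxtimes> A)) = f \<cdot> (Ident C X \<boxdot> ev)"
    using slide[of f ev, OF f(1) dual_pairD(3) refl refl refl refl] f o by simp
  finally show ?thesis using f u o by simp
qed

text \<open>A right adjoint preserves monomorphisms, a left adjoint preserves epimorphisms, and a left adjoint
  preserves projectivity if its right adjoint preserves epimorphisms.\<close>

lemma dual_pair_right_monic:
  assumes f: "monic C X Y f"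
  shows "monic C (X \<boxtimes> B) (Y \<boxtimes> B) (f \<boxdot> Ident C B)"
proof -
  note f' = monicD[OF f]
  show ?thesis
  proof (rule monicI)
    fix u v assume uv: "arr u" "arr v" "tgt u = X \<boxtimes> B" "tgt v = X \<boxtimes> B" "src u = src v"
      and e: "(f \<boxdot> Ident C B) \<cdot> u = (f \<boxdot> Ident C B) \<cdot> v"
    have "f \<cdot> ((Ident C X \<boxdot> ev) \<cdot> (u \<boxdot> Ident C A)) = f \<cdot> ((Ident C X \<boxdot> ev) \<cdot> (v \<boxdot> Ident C A))"
      using right_transpose_natural[OF f'(1-3) uv(1,3), unfolded e] right_transpose_natural[OF f'(1-3) uv(2,4)]
      by (rule trans[OF sym])
    then have eq: "(Ident C X \<boxdot> ev) \<cdot> (u \<boxdot> Ident C A) = (Ident C X \<boxdot> ev) \<cdot> (v \<boxdot> Ident C A)"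
      using f'(6)[of "(Ident C X \<boxdot> ev) \<cdot> (u \<boxdot> Ident C A)" "(Ident C X \<boxdot> ev) \<cdot> (v \<boxdot> Ident C A)"]
        f'(4) uv by simp
    show "u = v"
      using right_transpose_inverse2[OF uv(1) refl uv(3) f'(4), unfolded eq]
        right_transpose_inverse2[OF uv(2) uv(5)[symmetric] uv(4) f'(4)] by (rule trans[OF sym])
  qed (use f' in simp_all)
qed

lemma dual_pair_right_epic:
  assumes f: "epic C X Y f"
  shows "epic C (X \<boxtimes> A) (Y \<boxtimes> A) (f \<boxdot> Ident C A)"
proof -
  note f' = epicD[OF f]
  have *: "((u \<cdot> (f \<boxdot> Ident C A)) \<boxdot> Ident C B) \<cdot> (Ident C X \<boxdot> co)
      = ((u \<boxdot> Ident C B) \<cdot> (Ident C Y \<boxdot> co)) \<cdot> f"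
    if u: "arr u" "src u = Y \<boxtimes> A" for u
  proof -
    have "((u \<cdot> (f \<boxdot> Ident C A)) \<boxdot> Ident C B) \<cdot> (Ident C X \<boxdot> co)
        = (u \<boxdot> Ident C B) \<cdot> ((f \<boxdot> Ident C (A \<boxtimes> B)) \<cdot> (Ident C X \<boxdot> co))"
      using u f'(1-5) by (simp add: whisker_right_comp)
    also have "(f \<boxdot> Ident C (A \<boxtimes> B)) \<cdot> (Ident C X \<boxdot> co) = (Ident C Y \<boxdot> co) \<cdot> f"
      using slide[of f co, OF f'(1) dual_pairD(6) refl refl refl refl] f'(1-5) by simp
    finally show ?thesis using u f'(1-5) by simp
  qed
  show ?thesis
  proof (rule epicI)
    fix u v assume uv: "arr u" "arr v" "src u = Y \<boxtimes> A" "src v = Y \<boxtimes> A" "tgt u = tgt v"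
      and e: "u \<cdot> (f \<boxdot> Ident C A) = v \<cdot> (f \<boxdot> Ident C A)"
    have "((u \<boxdot> Ident C B) \<cdot> (Ident C Y \<boxdot> co)) \<cdot> f = ((v \<boxdot> Ident C B) \<cdot> (Ident C Y \<boxdot> co)) \<cdot> f"
      using *[OF uv(1,3), unfolded e] *[OF uv(2,4)] by (rule trans[OF sym])
    then have eq: "(u \<boxdot> Ident C B) \<cdot> (Ident C Y \<boxdot> co) = (v \<boxdot> Ident C B) \<cdot> (Ident C Y \<boxdot> co)"
      using f'(6)[of "(u \<boxdot> Ident C B) \<cdot> (Ident C Y \<boxdot> co)" "(v \<boxdot> Ident C B) \<cdot> (Ident C Y \<boxdot> co)"]
        f'(5) uv by simp
    show "u = v"
      using right_transpose_inverse1[OF uv(1,3,5) f'(5), unfolded eq]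
        right_transpose_inverse1[OF uv(2,4) refl f'(5)] by (rule trans[OF sym])
  qed (use f' in simp_all)
qed

lemma dual_pair_left_epic:
  assumes f: "epic C X Y f"
  shows "epic C (B \<boxtimes> X) (B \<boxtimes> Y) (Ident C B \<boxdot> f)"
proof -
  note f' = epicD[OF f]
  have *: "(Ident C A \<boxdot> (u \<cdot> (Ident C B \<boxdot> f))) \<cdot> (co \<boxdot> Ident C X)
      = ((Ident C A \<boxdot> u) \<cdot> (co \<boxdot> Ident C Y)) \<cdot> f"
    if u: "arr u" "src u = B \<boxtimes> Y" for u
  proof -
    have "(Ident C A \<boxdot> (u \<cdot> (Ident C B \<boxdot> f))) \<cdot> (co \<boxdot> Ident C X)
        = (Ident C A \<boxdot> u) \<cdot> ((Ident C (A \<boxtimes> B) \<boxdot> f) \<cdot> (co \<boxdot> Ident C X))"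
      using u f'(1-5) by (simp add: whisker_left_comp)
    also have "(Ident C (A \<boxtimes> B) \<boxdot> f) \<cdot> (co \<boxdot> Ident C X) = (co \<boxdot> Ident C Y) \<cdot> f"
      using slide[of co f, OF dual_pairD(6) f'(1) refl refl refl refl] f'(1-5) by simp
    finally show ?thesis using u f'(1-5) by simp
  qed
  show ?thesis
  proof (rule epicI)
    fix u v assume uv: "arr u" "arr v" "src u = B \<boxtimes> Y" "src v = B \<boxtimes> Y" "tgt u = tgt v"
      and e: "u \<cdot> (Ident C B \<boxdot> f) = v \<cdot> (Ident C B \<boxdot> f)"
    have "((Ident C A \<boxdot> u) \<cdot> (co \<boxdot> Ident C Y)) \<cdot> f = ((Ident C A \<boxdot> v) \<cdot> (co \<boxdot> Ident C Y)) \<cdot> f"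
      using *[OF uv(1,3), unfolded e] *[OF uv(2,4)] by (rule trans[OF sym])
    then have eq: "(Ident C A \<boxdot> u) \<cdot> (co \<boxdot> Ident C Y) = (Ident C A \<boxdot> v) \<cdot> (co \<boxdot> Ident C Y)"
      using f'(6)[of "(Ident C A \<boxdot> u) \<cdot> (co \<boxdot> Ident C Y)" "(Ident C A \<boxdot> v) \<cdot> (co \<boxdot> Ident C Y)"]
        f'(5) uv by simp
    show "u = v"
      using left_transpose_inverse1[OF uv(1,3,5) f'(5), unfolded eq]
        left_transpose_inverse1[OF uv(2,4) refl f'(5)] by (rule trans[OF sym])
  qed (use f' in simp_all)
qed

lemma dual_pair_right_projective:
  assumes V: "projective C V"
    and B: "\<And>X Y e. epic C X Y e \<Longrightarrow> epic C (X \<boxtimes> B) (Y \<boxtimes> B) (e \<boxdot> Ident C B)"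
  shows "projective C (V \<boxtimes> A)"
proof (rule projectiveI)
  have V': "V \<in> Obj C" using V unfolding projective_def by blast
  then show "V \<boxtimes> A \<in> Obj C" by simp
  fix X Y e f assume e: "epic C X Y e" and f: "arr f" "src f = V \<boxtimes> A" "tgt f = Y"
  note e' = epicD[OF e]
  obtain g where g: "arr g" "src g = V" "tgt g = X \<boxtimes> B"
    and eg: "(e \<boxdot> Ident C B) \<cdot> g = (f \<boxdot> Ident C B) \<cdot> (Ident C V \<boxdot> co)"
    by (rule projectiveD[OF V B[OF e], of "(f \<boxdot> Ident C B) \<cdot> (Ident C V \<boxdot> co)"])
      (use f V' in simp_all)
  have "e \<cdot> ((Ident C X \<boxdot> ev) \<cdot> (g \<boxdot> Ident C A)) = f"
    using right_transpose_natural[OF e'(1-3) g(1,3)] eg right_transpose_inverse1[OF f V'] by simp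
  then show "\<exists>g. arr g \<and> src g = V \<boxtimes> A \<and> tgt g = X \<and> e \<cdot> g = f"
    using g e'(4) by (intro exI[of _ "(Ident C X \<boxdot> ev) \<cdot> (g \<boxdot> Ident C A)"]) simp
qed

lemma dual_pair_left_projective:
  assumes V: "projective C V"
    and A: "\<And>X Y e. epic C X Y e \<Longrightarrow> epic C (A \<boxtimes> X) (A \<boxtimes> Y) (Ident C A \<boxdot> e)"
  shows "projective C (B \<boxtimes> V)"
proof (rule projectiveI)
  have V': "V \<in> Obj C" using V unfolding projective_def by blast
  then show "B \<boxtimes> V \<in> Obj C" by simp
  fix X Y e f assume e: "epic C X Y e" and f: "arr f" "src f = B \<boxtimes> V" "tgt f = Y"
  note e' = epicD[OF e]
  obtain g where g: "arr g" "src g = V" "tgt g = A \<boxtimes> X"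
    and eg: "(Ident C A \<boxdot> e) \<cdot> g = (Ident C A \<boxdot> f) \<cdot> (co \<boxdot> Ident C V)"
    by (rule projectiveD[OF V A[OF e], of "(Ident C A \<boxdot> f) \<cdot> (co \<boxdot> Ident C V)"])
      (use f V' in simp_all)
  have "Ident C B \<boxdot> ((Ident C A \<boxdot> e) \<cdot> g) = (Ident C (B \<boxtimes> A) \<boxdot> e) \<cdot> (Ident C B \<boxdot> g)"
    using e'(1-5) g by (simp add: whisker_left_comp)
  then have "(ev \<boxdot> Ident C Y) \<cdot> (Ident C B \<boxdot> ((Ident C A \<boxdot> e) \<cdot> g))
      = ((ev \<boxdot> Ident C Y) \<cdot> (Ident C (B \<boxtimes> A) \<boxdot> e)) \<cdot> (Ident C B \<boxdot> g)"
    using e'(1-5) g by simp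
  also have "(ev \<boxdot> Ident C Y) \<cdot> (Ident C (B \<boxtimes> A) \<boxdot> e) = e \<cdot> (ev \<boxdot> Ident C X)"
    using slide[of ev e, OF dual_pairD(3) e'(1) refl refl refl refl] e'(1-5) by simp
  finally have "e \<cdot> ((ev \<boxdot> Ident C X) \<cdot> (Ident C B \<boxdot> g)) = f"
    using eg left_transpose_inverse1[OF f V'] e'(1-5) g by simp
  then show "\<exists>g. arr g \<and> src g = B \<boxtimes> V \<and> tgt g = X \<and> e \<cdot> g = f"
    using g e'(4) by (intro exI[of _ "(ev \<boxdot> Ident C X) \<cdot> (Ident C B \<boxdot> g)"]) simp
qed

end

text \<open>The equation \<open>mate\<close> says that \<open>m'\<close> is the dual of \<open>m\<close>. It exhibits the transpose of \<open>h m'\<close> as the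
  transpose of \<open>h\<close> followed by the monomorphism \<open>m \<otimes> Z\<close>.\<close>

lemma mate_of_monic_epic:
  assumes X: "dual_pair X X' evX coX" and Y: "dual_pair Y Y' evY coY"
    and m: "monic C X Y m" and m': "arr m'" "src m' = Y'" "tgt m' = X'"
    and mate: "(m \<boxdot> Ident C X') \<cdot> coX = (Ident C Y \<boxdot> m') \<cdot> coY"
    and mon: "\<And>Z. Z \<in> Obj C \<Longrightarrow> monic C (X \<boxtimes> Z) (Y \<boxtimes> Z) (m \<boxdot> Ident C Z)"
  shows "epic C Y' X' m'"
proof (rule epicI[OF m'])
  note [simp] = dual_pairD[OF X] dual_pairD[OF Y] monicD(1-3)[OF m] m'
  have *: "(m \<boxdot> Ident C (tgt h)) \<cdot> ((Ident C X \<boxdot> h) \<cdot> coX) = (Ident C Y \<boxdot> (h \<cdot> m')) \<cdot> coY"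
    if h: "arr h" "src h = X'" for h
  proof -
    have "(m \<boxdot> Ident C (tgt h)) \<cdot> ((Ident C X \<boxdot> h) \<cdot> coX)
        = ((m \<boxdot> Ident C (tgt h)) \<cdot> (Ident C X \<boxdot> h)) \<cdot> coX"
      using h by simp
    also have "(m \<boxdot> Ident C (tgt h)) \<cdot> (Ident C X \<boxdot> h) = (Ident C Y \<boxdot> h) \<cdot> (m \<boxdot> Ident C X')"
      using slide[of m h, OF _ h(1) refl refl refl refl] h by simp
    also have "((Ident C Y \<boxdot> h) \<cdot> (m \<boxdot> Ident C X')) \<cdot> coX = (Ident C Y \<boxdot> h) \<cdot> ((m \<boxdot> Ident C X') \<cdot> coX)"
      using h by simp
    also have "\<dots> = (Ident C Y \<boxdot> (h \<cdot> m')) \<cdot> coY"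
      using h by (simp add: mate whisker_left_comp)
    finally show ?thesis .
  qed
  fix h k assume hk: "arr h" "arr k" "src h = X'" "src k = X'" "tgt h = tgt k" "h \<cdot> m' = k \<cdot> m'"
  have "(m \<boxdot> Ident C (tgt k)) \<cdot> ((Ident C X \<boxdot> h) \<cdot> coX) = (m \<boxdot> Ident C (tgt k)) \<cdot> ((Ident C X \<boxdot> k) \<cdot> coX)"
    using *[of h] *[of k] hk by simp
  then have "(Ident C X \<boxdot> h) \<cdot> coX = (Ident C X \<boxdot> k) \<cdot> coX"
    using monicD(6)[OF mon[of "tgt k"], of "(Ident C X \<boxdot> h) \<cdot> coX" "(Ident C X \<boxdot> k) \<cdot> coX"] hk by simp
  then show "h = k" using coev_left_inj[OF X, of h "tgt k" k] hk by simp
qed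

end

section \<open>Projective objects of pivotal categories\<close>

context pivotal_tensor_category
begin

declare dual_in_obj [simp]

lemma dual_pair_left: "V \<in> Obj C \<Longrightarrow> dual_pair V (Dual C V) (LEv C V) (LCoev C V)"
  using lev_in_hom[of V] lcoev_in_hom[of V] mor_iff left_zigzag left_zigzag_dual
  unfolding dual_pair_def by simp

lemma dual_pair_right: "V \<in> Obj C \<Longrightarrow> dual_pair (Dual C V) V (REv C V) (RCoev C V)"
  using rev_in_hom[of V] rcoev_in_hom[of V] mor_iff right_zigzag right_zigzag_dual
  unfolding dual_pair_def by simp

lemmas lev_arr [simp] = dual_pairD(3-5)[OF dual_pair_left]
  and lcoev_arr [simp] = dual_pairD(6-8)[OF dual_pair_left]
  and rev_arr [simp] = dual_pairD(3-5)[OF dual_pair_right]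
  and rcoev_arr [simp] = dual_pairD(6-8)[OF dual_pair_right]

lemma tensor_right_monic:
  "\<lbrakk>monic C X Y f; Z \<in> Obj C\<rbrakk> \<Longrightarrow> monic C (X \<boxtimes> Z) (Y \<boxtimes> Z) (f \<boxdot> Ident C Z)"
  by (rule dual_pair_right_monic[OF dual_pair_right])

lemma tensor_right_epic:
  "\<lbrakk>epic C X Y f; Z \<in> Obj C\<rbrakk> \<Longrightarrow> epic C (X \<boxtimes> Z) (Y \<boxtimes> Z) (f \<boxdot> Ident C Z)"
  by (rule dual_pair_right_epic[OF dual_pair_left])

lemma tensor_left_epic:
  "\<lbrakk>epic C X Y f; Z \<in> Obj C\<rbrakk> \<Longrightarrow> epic C (Z \<boxtimes> X) (Z \<boxtimes> Y) (Ident C Z \<boxdot> f)"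
  by (rule dual_pair_left_epic[OF dual_pair_right])

lemma tensor_right_projective: "\<lbrakk>projective C V; Z \<in> Obj C\<rbrakk> \<Longrightarrow> projective C (V \<boxtimes> Z)"
  by (rule dual_pair_right_projective[OF dual_pair_left]) (auto intro: tensor_right_epic)

lemma tensor_left_projective: "\<lbrakk>projective C V; Z \<in> Obj C\<rbrakk> \<Longrightarrow> projective C (Z \<boxtimes> V)"
  by (rule dual_pair_left_projective[OF dual_pair_right]) (auto intro: tensor_left_epic)

text \<open>By a zigzag identity, \<open>V*\<close> is a retract of \<open>V* V V*\<close>.\<close>

lemma projective_dual:
  assumes V: "projective C V"
  shows "projective C (Dual C V)"
proof (rule projective_retract)
  have o [simp]: "V \<in> Obj C" using V unfolding projective_def by blast
  show "projective C (Dual C V \<boxtimes> V \<boxtimes> Dual C V)"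
    by (intro tensor_left_projective tensor_right_projective V) simp_all
  show "(LEv C V \<boxdot> Ident C (Dual C V)) \<cdot> (Ident C (Dual C V) \<boxdot> LCoev C V) = Ident C (Dual C V)"
    by (rule left_zigzag_dual) simp
qed (use V in \<open>auto simp: projective_def\<close>)

text \<open>Passing to duals turns the extension problem for \<open>f : X \<rightarrow> W\<close> along a monomorphism \<open>m\<close> into the
  lifting problem for \<open>f* : V \<rightarrow> X*\<close> along the epimorphism \<open>m*\<close>.\<close>

lemma left_dual_of_projective_injective:
  assumes W: "dual_pair W V ev co" and V: "projective C V"
  shows "injective C W"
proof (rule injectiveI)
  note [simp] = dual_pairD[OF W]
  show "W \<in> Obj C" by simp
  fix X Y m f assume m: "monic C X Y m" and f: "arr f" "src f = X" "tgt f = W"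
  note m' [simp] = monicD(1-5)[OF m] and f [simp]
  note Xp = dual_pair_left[OF m'(4)] and Yp = dual_pair_left[OF m'(5)]
  obtain n where n [simp]: "arr n" "src n = Dual C Y" "tgt n = Dual C X"
    and mn: "(Ident C Y \<boxdot> n) \<cdot> LCoev C Y = (m \<boxdot> Ident C (Dual C X)) \<cdot> LCoev C X"
    by (rule coev_left_surj[OF Yp, of "(m \<boxdot> Ident C (Dual C X)) \<cdot> LCoev C X" "Dual C X"]) simp_all
  have n_epic: "epic C (Dual C Y) (Dual C X) n"
    by (rule mate_of_monic_epic[OF Xp Yp m n mn[symmetric] tensor_right_monic[OF m]])
  obtain f' where f' [simp]: "arr f'" "src f' = V" "tgt f' = Dual C X"
    and ff: "(Ident C W \<boxdot> f') \<cdot> co = (f \<boxdot> Ident C (Dual C X)) \<cdot> LCoev C X"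
    by (rule coev_left_surj[OF W, of "(f \<boxdot> Ident C (Dual C X)) \<cdot> LCoev C X" "Dual C X"]) simp_all
  obtain h where h [simp]: "arr h" "src h = V" "tgt h = Dual C Y" and nh: "n \<cdot> h = f'"
    by (rule projectiveD[OF V n_epic f'])
  obtain g where g [simp]: "arr g" "src g = Y" "tgt g = W"
    and gh: "(g \<boxdot> Ident C (Dual C Y)) \<cdot> LCoev C Y = (Ident C W \<boxdot> h) \<cdot> co"
    by (rule coev_right_surj[OF Yp, of "(Ident C W \<boxdot> h) \<cdot> co" W]) simp_all
  have "((g \<cdot> m) \<boxdot> Ident C (Dual C X)) \<cdot> LCoev C X
      = (g \<boxdot> Ident C (Dual C X)) \<cdot> ((m \<boxdot> Ident C (Dual C X)) \<cdot> LCoev C X)"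
    by (simp add: whisker_right_comp)
  also have "\<dots> = ((g \<boxdot> Ident C (Dual C X)) \<cdot> (Ident C Y \<boxdot> n)) \<cdot> LCoev C Y"
    by (simp flip: mn)
  also have "(g \<boxdot> Ident C (Dual C X)) \<cdot> (Ident C Y \<boxdot> n) = (Ident C W \<boxdot> n) \<cdot> (g \<boxdot> Ident C (Dual C Y))"
    by (rule slide[symmetric]) simp_all
  also have "((Ident C W \<boxdot> n) \<cdot> (g \<boxdot> Ident C (Dual C Y))) \<cdot> LCoev C Y
      = (Ident C W \<boxdot> n) \<cdot> ((Ident C W \<boxdot> h) \<cdot> co)"
    by (simp add: gh)
  also have "\<dots> = (Ident C W \<boxdot> (n \<cdot> h)) \<cdot> co"
    by (simp add: whisker_left_comp)
  also have "\<dots> = (f \<boxdot> Ident C (Dual C X)) \<cdot> LCoev C X"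
    unfolding nh ff ..
  finally have "g \<cdot> m = f"
    by (intro coev_right_inj[OF Xp, of "g \<cdot> m" W f]) simp_all
  then show "\<exists>g. arr g \<and> src g = Y \<and> tgt g = W \<and> g \<cdot> m = f" using g by blast
qed

lemma projective_imp_injective:
  assumes V: "projective C V"
  shows "injective C V"
proof -
  have "V \<in> Obj C" using V unfolding projective_def by blast
  then show ?thesis
    by (rule left_dual_of_projective_injective[OF dual_pair_left projective_dual[OF V]])
qed

text \<open>The left dual of \<open>g\<close> is characterised by the first equation and the right dual by the
  second; both hold for the same morphism because the two duals coincide.\<close>

lemma dual_mate:
  assumes g: "arr g" "src g = U" "tgt g = V"
  obtains g' where "arr g'" "src g' = Dual C V" "tgt g' = Dual C U"
    "(g \<boxdot> Ident C (Dual C U)) \<cdot> LCoev C U = (Ident C V \<boxdot> g') \<cdot> LCoev C V"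
    "REv C V \<cdot> (g \<boxdot> Ident C (Dual C V)) = REv C U \<cdot> (Ident C U \<boxdot> g')"
proof -
  have o [simp]: "U \<in> Obj C" "V \<in> Obj C" using g by auto
  note g [simp]
  let ?g = "left_dual_mor C U V g"
  have l: "?g = (LEv C V \<boxdot> Ident C (Dual C U)) \<cdot> (Ident C (Dual C V) \<boxdot>
      ((g \<boxdot> Ident C (Dual C U)) \<cdot> LCoev C U))"
    unfolding left_dual_mor_def by (simp add: whisker_left_comp)
  have "(Ident C V \<boxdot> ?g) \<cdot> LCoev C V = (g \<boxdot> Ident C (Dual C U)) \<cdot> LCoev C U"
    using left_transpose_inverse2[OF dual_pair_left[OF o(2)],
        of "(g \<boxdot> Ident C (Dual C U)) \<cdot> LCoev C U" "Unit C" "Dual C U"]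
    unfolding l by simp
  moreover have "?g = right_dual_mor C U V g"
    using dual_mor_coincide[OF o] arr_mor[OF g(1)] by simp
  then have r: "?g = (Ident C (Dual C U) \<boxdot> (REv C V \<cdot> (g \<boxdot> Ident C (Dual C V)))) \<cdot>
      (RCoev C U \<boxdot> Ident C (Dual C V))"
    unfolding right_dual_mor_def by (simp add: whisker_left_comp)
  have "REv C U \<cdot> (Ident C U \<boxdot> ?g) = REv C V \<cdot> (g \<boxdot> Ident C (Dual C V))"
    using left_transpose_inverse1[OF dual_pair_right[OF o(1)],
        of "REv C V \<cdot> (g \<boxdot> Ident C (Dual C V))" "Dual C V" "Unit C"]
    unfolding r by simp
  moreover have "arr ?g" "src ?g = Dual C V" "tgt ?g = Dual C U"
    unfolding l by simp_all
  ultimately show thesis using that by metis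
qed

lemma zero_object_of_lcoev_zero:
  assumes V: "V \<in> Obj C" and z: "LCoev C V = zero_mor (Unit C) (V \<boxtimes> Dual C V)"
  shows "zero_object C V"
  using left_zigzag[OF V] V unfolding z by (simp add: zero_object_iff)

end

section \<open>Simplicity of the unit object\<close>

locale pivotal_abelian_category =
  pivotal_tensor_category K C + abelian_category K C + scalars: field K
  for K :: "('k, 'r) ring_scheme" and C :: "('k, 'o, 'm, 'z) pivotal_cat_scheme" (structure)
begin

lemma unit_scalar:
  assumes "arr x" "src x = Unit C" "tgt x = Unit C"
  obtains a where "a \<in> carrier K" "x = a \<odot>\<^bsub>Hom C (Unit C) (Unit C)\<^esub> Ident C (Unit C)"
  using scalars_iso_end_unit arr_mor[OF assms(1)] assms(2,3) unfolding bij_betw_def by auto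

lemma unit_nonzero: "\<not> zero_object C (Unit C)"
proof
  assume "zero_object C (Unit C)"
  then have e: "Ident C (Unit C) = zero_mor (Unit C) (Unit C)" by (simp add: zero_object_iff)
  interpret E: module K "Hom C (Unit C) (Unit C)" using hom_module by simp
  have "\<forall>a\<in>carrier K. \<forall>b\<in>carrier K. a = b"
    using scalars_iso_end_unit unfolding bij_betw_def inj_on_def e by simp
  then show False using scalars.one_not_zero scalars.one_closed scalars.zero_closed by blast
qed

text \<open>The endomorphisms of the unit object form the field of scalars.\<close>

lemma unit_endo_right_invertible:
  assumes x: "arr x" "src x = Unit C" "tgt x = Unit C" and nz: "x \<noteq> zero_mor (Unit C) (Unit C)"
  obtains y where "arr y" "src y = Unit C" "tgt y = Unit C" "x \<cdot> y = Ident C (Unit C)"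
proof -
  interpret E: module K "Hom C (Unit C) (Unit C)" using hom_module by simp
  have I: "Ident C (Unit C) \<in> Mor C (Unit C) (Unit C)" by (simp add: ident_in_hom)
  obtain a where a: "a \<in> carrier K" "x = a \<odot>\<^bsub>Hom C (Unit C) (Unit C)\<^esub> Ident C (Unit C)"
    by (rule unit_scalar[OF x])
  have "a \<noteq> \<zero>\<^bsub>K\<^esub>" using nz a I by auto
  then have u: "a \<in> Units K" using a scalars.field_Units by auto
  define y where "y = inv\<^bsub>K\<^esub> a \<odot>\<^bsub>Hom C (Unit C) (Unit C)\<^esub> Ident C (Unit C)"
  have "y \<in> Mor C (Unit C) (Unit C)" unfolding y_def using I u by auto
  then have y: "arr y" "src y = Unit C" "tgt y = Unit C" using mor_iff by auto
  have "x \<cdot> y = inv\<^bsub>K\<^esub> a \<odot>\<^bsub>Hom C (Unit C) (Unit C)\<^esub> (x \<cdot> Ident C (Unit C))"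
    unfolding y_def by (rule comp_smult_right) (use x u in auto)
  also have "\<dots> = (inv\<^bsub>K\<^esub> a \<otimes>\<^bsub>K\<^esub> a) \<odot>\<^bsub>Hom C (Unit C) (Unit C)\<^esub> Ident C (Unit C)"
    using x a I E.smult_assoc1[OF scalars.Units_inv_closed[OF u] a(1) I] by simp
  also have "\<dots> = Ident C (Unit C)" using u I by simp
  finally show thesis using that y by blast
qed

text \<open>Let \<open>j : X \<rightarrow> 1\<close> be a simple subobject. Its dual \<open>1 \<rightarrow> X*\<close> is epic, hence so is the induced
  \<open>X \<rightarrow> X X*\<close>, which is then an isomorphism because \<open>X\<close> is simple and \<open>X X*\<close> is nonzero. The
  coevaluation followed by the inverse of this isomorphism and by \<open>j\<close> is a nonzero endomorphism of
  the unit object, hence invertible, so that \<open>j\<close> is an isomorphism.\<close>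

lemma unit_simple:
  assumes fin: "finite_length_object C (Unit C)"
  shows "simple_object C (Unit C)"
proof -
  obtain X j where X: "simple_object C X" and j: "monic C X (Unit C) j"
    using simple_subobject_exists[OF fin unit_nonzero] .
  note j' [simp] = monicD(1-4)[OF j]
  have up: "dual_pair (Unit C) (Unit C) (Ident C (Unit C)) (Ident C (Unit C))"
    unfolding dual_pair_def by simp
  \<comment> \<open>the dual \<open>1 \<rightarrow> X*\<close> of \<open>j\<close>, the unit object being its own dual\<close>
  define k where "k = (j \<boxdot> Ident C (Dual C X)) \<cdot> LCoev C X"
  have k [simp]: "arr k" "src k = Unit C" "tgt k = Dual C X" unfolding k_def by simp_all
  have "epic C (Unit C) (Dual C X) k"
    by (rule mate_of_monic_epic[OF dual_pair_left[OF j'(4)] up j k _ tensor_right_monic[OF j]])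
      (simp_all add: k_def)
  then have e: "epic C X (X \<boxtimes> Dual C X) (Ident C X \<boxdot> k)"
    using tensor_left_epic[of "Unit C" "Dual C X" k X] by simp
  have nz: "Ident C X \<boxdot> k \<noteq> zero_mor X (X \<boxtimes> Dual C X)"
  proof
    assume z: "Ident C X \<boxdot> k = zero_mor X (X \<boxtimes> Dual C X)"
    have "Ident C (X \<boxtimes> Dual C X) = zero_mor (X \<boxtimes> Dual C X) (X \<boxtimes> Dual C X)"
      using epicD(6)[OF e, of "Ident C (X \<boxtimes> Dual C X)" "zero_mor (X \<boxtimes> Dual C X) (X \<boxtimes> Dual C X)"]
      unfolding z by simp
    then have "LCoev C X = zero_mor (Unit C) (X \<boxtimes> Dual C X)"
      using to_zero_object[of "X \<boxtimes> Dual C X" "LCoev C X"] by (simp add: zero_object_iff)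
    then show False using zero_object_of_lcoev_zero[OF j'(4)] simple_objectD(2)[OF X] by simp
  qed
  have "monic C X (X \<boxtimes> Dual C X) (Ident C X \<boxdot> k)"
    using from_simple_monic[OF X, of "Ident C X \<boxdot> k"] nz by simp
  then obtain s where s [simp]: "arr s" "src s = X \<boxtimes> Dual C X" "tgt s = X"
    and ks: "(Ident C X \<boxdot> k) \<cdot> s = Ident C (X \<boxtimes> Dual C X)"
    using iso_morD[OF monic_epic_iso[OF _ e]] by metis
  have "j \<cdot> (s \<cdot> LCoev C X) \<noteq> zero_mor (Unit C) (Unit C)"
  proof
    assume "j \<cdot> (s \<cdot> LCoev C X) = zero_mor (Unit C) (Unit C)"
    then have sz: "s \<cdot> LCoev C X = zero_mor (Unit C) X"
      using monicD(6)[OF j, of "s \<cdot> LCoev C X" "zero_mor (Unit C) X"] by simp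
    have "LCoev C X = ((Ident C X \<boxdot> k) \<cdot> s) \<cdot> LCoev C X" using ks by simp
    also have "\<dots> = (Ident C X \<boxdot> k) \<cdot> (s \<cdot> LCoev C X)" by simp
    also have "\<dots> = zero_mor (Unit C) (X \<boxtimes> Dual C X)" unfolding sz by simp
    finally show False using zero_object_of_lcoev_zero[OF j'(4)] simple_objectD(2)[OF X] by simp
  qed
  then obtain y where y [simp]: "arr y" "src y = Unit C" "tgt y = Unit C"
    and jy: "(j \<cdot> (s \<cdot> LCoev C X)) \<cdot> y = Ident C (Unit C)"
    using unit_endo_right_invertible[of "j \<cdot> (s \<cdot> LCoev C X)"] by auto
  define r where "r = s \<cdot> LCoev C X \<cdot> y"
  have r [simp]: "arr r" "src r = Unit C" "tgt r = X" unfolding r_def by simp_all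
  have jr: "j \<cdot> r = Ident C (Unit C)" using jy unfolding r_def by simp
  have "j \<cdot> (r \<cdot> j) = j \<cdot> Ident C X"
    using comp_assoc_arr[of j r j] jr by (simp del: comp_assoc_arr)
  then have rj: "r \<cdot> j = Ident C X" using monicD(6)[OF j, of "r \<cdot> j" "Ident C X"] by simp
  have r_monic: "monic C (Unit C) X r"
  proof (rule monicI[OF r])
    fix g h assume gh: "arr g" "arr h" "tgt g = Unit C" "tgt h = Unit C" "r \<cdot> g = r \<cdot> h"
    have "(j \<cdot> r) \<cdot> g = (j \<cdot> r) \<cdot> h" using gh by simp
    then show "g = h" using gh jr by simp
  qed
  have "zero_object C Z \<or> iso_mor C Z (Unit C) f" if f: "monic C Z (Unit C) f" for Z f
  proof -
    note f' [simp] = monicD(1-4)[OF f]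
    have "zero_object C Z \<or> iso_mor C Z X (r \<cdot> f)"
      using simple_objectD(3)[OF X monic_comp[OF f r_monic]] .
    moreover have "iso_mor C Z (Unit C) f" if rf: "iso_mor C Z X (r \<cdot> f)"
    proof -
      obtain g where g [simp]: "arr g" "src g = X" "tgt g = Z" and gf: "g \<cdot> (r \<cdot> f) = Ident C Z"
        and fg: "(r \<cdot> f) \<cdot> g = Ident C X"
        using iso_morD[OF rf] by metis
      have "f \<cdot> (g \<cdot> r) = (j \<cdot> r) \<cdot> (f \<cdot> (g \<cdot> r))" using jr by simp
      also have "\<dots> = j \<cdot> (((r \<cdot> f) \<cdot> g) \<cdot> r)" by simp
      also have "\<dots> = Ident C (Unit C)" unfolding fg using jr by simp
      finally show ?thesis using gf by (intro iso_morI[of f _ _ "g \<cdot> r"]) simp_all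
    qed
    ultimately show ?thesis by blast
  qed
  then show ?thesis unfolding simple_object_def using unit_nonzero by simp
qed

end

section \<open>The injective hull of the unit object\<close>

locale unit_hull = pivotal_abelian_category K C
  for K :: "('k, 'r) ring_scheme" and C :: "('k, 'o, 'm, 'z) pivotal_cat_scheme" (structure) +
  fixes P :: 'o and i :: 'm
  assumes hull: "injective_hull C (Unit C) P i"
    and simple_unit: "simple_object C (Unit C)"
begin

lemma hull_monic: "monic C (Unit C) P i" and hull_injective: "injective C P"
  using hull unfolding injective_hull_def by auto

lemma hull_arr [simp]: "arr i" "src i = Unit C" "tgt i = P" "P \<in> Obj C"
  using monicD[OF hull_monic] by auto

lemma hull_nonzero: "i \<noteq> zero_mor (Unit C) P"
proof
  assume "i = zero_mor (Unit C) P"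
  then have "Ident C (Unit C) = zero_mor (Unit C) (Unit C)"
    using monicD(6)[OF hull_monic, of "Ident C (Unit C)" "zero_mor (Unit C) (Unit C)"] by simp
  then show False using unit_nonzero by (simp add: zero_object_iff)
qed

text \<open>The hull is an essential extension of a simple object.\<close>

lemma monic_of_nonzero_on_hull:
  assumes g: "arr g" "src g = P" and nz: "g \<cdot> i \<noteq> zero_mor (Unit C) (tgt g)"
  shows "monic C P (tgt g) g"
proof -
  have "monic C (Unit C) (tgt g) (g \<cdot> i)"
    using from_simple_monic[OF simple_unit, of "g \<cdot> i"] g nz by simp
  then show ?thesis using hull arr_mor[of g] g unfolding injective_hull_def by auto
qed

text \<open>A nonzero \<open>x : 1 \<rightarrow> P\<close> is the kernel of some \<open>g\<close>. As \<open>g\<close> is not monic, it also kills \<open>i\<close>, so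
  \<open>i\<close> factors through \<open>x\<close> by an endomorphism of the unit object, which is a nonzero scalar.\<close>

lemma unit_to_hull_scalar:
  assumes x: "arr x" "src x = Unit C" "tgt x = P"
  obtains a where "a \<in> carrier K" "x = a \<odot>\<^bsub>Hom C (Unit C) P\<^esub> i"
proof (cases "x = zero_mor (Unit C) P")
  case True
  interpret module K "Hom C (Unit C) P" using hom_module by simp
  have "i \<in> Mor C (Unit C) P" using arr_mor[of i] by simp
  then have "x = \<zero>\<^bsub>K\<^esub> \<odot>\<^bsub>Hom C (Unit C) P\<^esub> i" using True by simp
  then show thesis using that by blast
next
  case False
  then have "monic C (Unit C) P x" using from_simple_monic[OF simple_unit, of x] x by simp
  then obtain Z g where k: "is_kernel C P Z g (Unit C) x" using monic_is_kernel by blast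
  have o: "Z \<in> Obj C" "g \<in> Mor C P Z" using k unfolding is_kernel_def by auto
  then have g: "arr g" "src g = P" "tgt g = Z" using mor_iff by auto
  note k' = is_kernelD[OF k]
  have "g \<cdot> i = zero_mor (Unit C) Z"
  proof (rule ccontr)
    assume "g \<cdot> i \<noteq> zero_mor (Unit C) Z"
    then have "monic C P Z g" using monic_of_nonzero_on_hull[of g] g by simp
    then have "x = zero_mor (Unit C) P"
      using monicD(6)[of P Z g x "zero_mor (Unit C) P"] k'(4) x g o by simp
    then show False using False by contradiction
  qed
  then obtain u where u: "arr u" "src u = Unit C" "tgt u = Unit C" "x \<cdot> u = i"
    using k'(6)[of i] by auto
  have "u \<noteq> zero_mor (Unit C) (Unit C)" using u(4) hull_nonzero x by auto
  then obtain y where y: "arr y" "src y = Unit C" "tgt y = Unit C" "u \<cdot> y = Ident C (Unit C)"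
    using unit_endo_right_invertible[OF u(1-3)] by blast
  have "i \<cdot> y = (x \<cdot> u) \<cdot> y" using u(4) by simp
  also have "\<dots> = x" using x u(1-3) y by simp
  finally have iy: "i \<cdot> y = x" .
  obtain a where a: "a \<in> carrier K" "y = a \<odot>\<^bsub>Hom C (Unit C) (Unit C)\<^esub> Ident C (Unit C)"
    using unit_scalar[OF y(1-3)] .
  have "x = a \<odot>\<^bsub>Hom C (Unit C) P\<^esub> i"
    using comp_smult_right[OF a(1), of "Ident C (Unit C)" i] iy a(2) by simp
  then show thesis using that a(1) by blast
qed

text \<open>An endomorphism \<open>f\<close> that does not kill \<open>i\<close> is monic, so it has a retraction \<open>r\<close> because \<open>P\<close> is
  injective. Since \<open>f i\<close> is a multiple of \<open>i\<close>, \<open>r\<close> does not kill \<open>i\<close> either and is monic as well.\<close>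

lemma hull_endo_iso:
  assumes f: "arr f" "src f = P" "tgt f = P" and nz: "f \<cdot> i \<noteq> zero_mor (Unit C) P"
  obtains r where "arr r" "src r = P" "tgt r = P" "r \<cdot> f = Ident C P" "f \<cdot> r = Ident C P"
proof -
  have "monic C P P f" using monic_of_nonzero_on_hull[of f] f nz by simp
  then obtain r where r: "arr r" "src r = P" "tgt r = P" "r \<cdot> f = Ident C P"
    using injectiveD[OF hull_injective, of P P f "Ident C P"] by auto
  obtain a where a: "a \<in> carrier K" "f \<cdot> i = a \<odot>\<^bsub>Hom C (Unit C) P\<^esub> i"
    by (rule unit_to_hull_scalar[of "f \<cdot> i"]) (use f in simp_all)
  have "a \<odot>\<^bsub>Hom C (Unit C) P\<^esub> (r \<cdot> i) = r \<cdot> (f \<cdot> i)"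
    unfolding a(2) by (rule comp_smult_right[symmetric]) (use a r in simp_all)
  also have "\<dots> = i" using r f comp_assoc_arr[of r f i] by (simp del: comp_assoc_arr)
  finally have ri: "a \<odot>\<^bsub>Hom C (Unit C) P\<^esub> (r \<cdot> i) = i" .
  interpret module K "Hom C (Unit C) P" using hom_module by simp
  have "r \<cdot> i \<noteq> zero_mor (Unit C) P" using ri a(1) hull_nonzero by auto
  then have m: "monic C P P r" using monic_of_nonzero_on_hull[of r] r by simp
  have "r \<cdot> (f \<cdot> r) = r \<cdot> Ident C P" using r f comp_assoc_arr[of r f r] by (simp del: comp_assoc_arr)
  then have "f \<cdot> r = Ident C P" using monicD(6)[OF m, of "f \<cdot> r" "Ident C P"] r f by simp
  then show thesis using that r by blast
qed

text \<open>If \<open>Q\<close> is projective and nonzero, then \<open>Q Q*\<close> is projective, injective, and contains the unit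
  object by coevaluation. The hull is a direct summand of every such object.\<close>

lemma hull_projective:
  assumes ep: "enough_projectives C"
  shows "projective C P"
proof -
  obtain Q q where Q: "projective C Q" and q: "epic C Q (Unit C) q"
    using ep unfolding enough_projectives_def projective_cover_def by (meson unit_in_obj)
  note q' [simp] = epicD(1-4)[OF q]
  let ?W = "Q \<boxtimes> Dual C Q"
  have W: "projective C ?W" by (rule tensor_right_projective[OF Q]) simp
  have "LCoev C Q \<noteq> zero_mor (Unit C) ?W"
  proof
    assume "LCoev C Q = zero_mor (Unit C) ?W"
    then have "zero_object C Q" by (intro zero_object_of_lcoev_zero) simp_all
    then have "q = zero_mor Q (Unit C)" using from_zero_object[of Q q] by simp
    then have "Ident C (Unit C) = zero_mor (Unit C) (Unit C)"
      using epicD(6)[OF q, of "Ident C (Unit C)" "zero_mor (Unit C) (Unit C)"] by simp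
    then show False using unit_nonzero by (simp add: zero_object_iff)
  qed
  then have m: "monic C (Unit C) ?W (LCoev C Q)"
    using from_simple_monic[OF simple_unit, of "LCoev C Q"] by simp
  obtain e where e [simp]: "arr e" "src e = P" "tgt e = ?W" and ei: "e \<cdot> i = LCoev C Q"
    by (rule injectiveD[OF projective_imp_injective[OF W] hull_monic, of "LCoev C Q"]) simp_all
  obtain s where s [simp]: "arr s" "src s = ?W" "tgt s = P" and sc: "s \<cdot> LCoev C Q = i"
    by (rule injectiveD[OF hull_injective m, of i]) simp_all
  have "(s \<cdot> e) \<cdot> i = i" using ei sc by simp
  then have "(s \<cdot> e) \<cdot> i \<noteq> zero_mor (Unit C) P" using hull_nonzero by simp
  then obtain r where r: "arr r" "src r = P" "tgt r = P" "r \<cdot> (s \<cdot> e) = Ident C P"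
    by (rule hull_endo_iso[of "s \<cdot> e", rotated 3]) simp_all
  show ?thesis
    by (rule projective_retract[OF W e(1-3), of "r \<cdot> s"]) (use r in simp_all)
qed

end

section \<open>Pairing morphisms to the head with morphisms from the unit\<close>

locale unit_hull_head = unit_hull K C P i
  for K :: "('k, 'r) ring_scheme" and C :: "('k, 'o, 'm, 'z) pivotal_cat_scheme" (structure)
    and P :: 'o and i :: 'm +
  fixes \<beta> :: 'o and p :: 'm
  assumes P_projective: "projective C P"
    and simple_head: "simple_object C \<beta>"
    and head_epic: "epic C P \<beta> p"
begin

lemma head_arr [simp]: "arr p" "src p = P" "tgt p = \<beta>" "\<beta> \<in> Obj C"
  using epicD[OF head_epic] by auto

lemma head_nonzero: "p \<noteq> zero_mor P \<beta>"
proof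
  assume "p = zero_mor P \<beta>"
  then have "Ident C \<beta> = zero_mor \<beta> \<beta>"
    using epicD(6)[OF head_epic, of "Ident C \<beta>" "zero_mor \<beta> \<beta>"] by simp
  then show False using simple_objectD(2)[OF simple_head] by (simp add: zero_object_iff)
qed

text \<open>An invertible \<open>f\<close> with \<open>p f = 0\<close> would force \<open>p = 0\<close>.\<close>

lemma hull_endo_kills:
  assumes f: "arr f" "src f = P" "tgt f = P" and pf: "p \<cdot> f = zero_mor P \<beta>"
  shows "f \<cdot> i = zero_mor (Unit C) P"
proof (rule ccontr)
  assume "f \<cdot> i \<noteq> zero_mor (Unit C) P"
  then obtain r where r: "arr r" "src r = P" "tgt r = P" "f \<cdot> r = Ident C P"
    by (rule hull_endo_iso[OF f])
  have "p = (p \<cdot> f) \<cdot> r" using f r by simp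
  also have "\<dots> = zero_mor P \<beta>" unfolding pf using r by simp
  finally show False using head_nonzero by contradiction
qed

definition lifts_to :: "'m \<Rightarrow> 'm \<Rightarrow> bool"
  where "lifts_to m h \<longleftrightarrow> arr h \<and> src h = src m \<and> tgt h = P \<and> p \<cdot> h = m"

text \<open>By \<open>lift_comp_unique\<close> the scalar does not depend on the lift, provided that the source of \<open>m\<close> is
  projective.\<close>

definition head_pairing :: "'m \<Rightarrow> 'm \<Rightarrow> 'k"
  where "head_pairing m x = (THE a. a \<in> carrier K \<and>
    (\<exists>h. lifts_to m h \<and> h \<cdot> x = a \<odot>\<^bsub>Hom C (Unit C) P\<^esub> i))"

lemma lift_exists:
  assumes "projective C W" "arr m" "src m = W" "tgt m = \<beta>"
  obtains h where "lifts_to m h"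
  using projectiveD[OF assms(1) head_epic assms(2-4)] assms(3) unfolding lifts_to_def by metis

text \<open>The difference \<open>d\<close> of two lifts satisfies \<open>p d = 0\<close>. Since \<open>W\<close> is injective, \<open>x = e i\<close> for some
  \<open>e : P \<rightarrow> W\<close>, and \<open>d e\<close> is an endomorphism of \<open>P\<close> that must kill \<open>i\<close>.\<close>

lemma lift_comp_unique:
  assumes W: "projective C W" and h: "lifts_to m h" "lifts_to m k" and m: "src m = W"
    and x: "arr x" "src x = Unit C" "tgt x = W"
  shows "h \<cdot> x = k \<cdot> x"
proof -
  have h' [simp]: "arr h" "src h = W" "tgt h = P" "arr k" "src k = W" "tgt k = P"
    and ph: "p \<cdot> h = m" "p \<cdot> k = m"
    using h m unfolding lifts_to_def by auto
  note x [simp]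
  have W' [simp]: "W \<in> Obj C" using src_tgt_obj(2)[OF x(1)] by simp
  obtain e where e [simp]: "arr e" "src e = P" "tgt e = W" and ei: "e \<cdot> i = x"
    by (rule injectiveD[OF projective_imp_injective[OF W] hull_monic x])
  let ?d = "h \<ominus>\<^bsub>Hom C W P\<^esub> k"
  note d [simp] = minus_arr[of h k W P, OF h'(1,4,2,5,3,6)]
  have hk: "h \<in> Mor C W P" "k \<in> Mor C W P" "p \<in> Mor C P \<beta>"
    using mor_iff by auto
  have "p \<cdot> ?d = p \<cdot> h \<ominus>\<^bsub>Hom C W \<beta>\<^esub> p \<cdot> k"
    by (rule comp_minus_right) (use hk in simp_all)
  also have "\<dots> = zero_mor W \<beta>"
    using minus_arr(4)[of m m W \<beta>] comp_arr[of p h] unfolding ph by simp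
  finally have pd: "p \<cdot> ?d = zero_mor W \<beta>" .
  have "p \<cdot> (?d \<cdot> e) = (p \<cdot> ?d) \<cdot> e" by simp
  also have "\<dots> = zero_mor P \<beta>" unfolding pd by simp
  finally have "(?d \<cdot> e) \<cdot> i = zero_mor (Unit C) P"
    by (intro hull_endo_kills) simp_all
  then have "?d \<cdot> x = zero_mor (Unit C) P" using ei by simp
  moreover have "?d \<cdot> x = h \<cdot> x \<ominus>\<^bsub>Hom C (Unit C) P\<^esub> k \<cdot> x"
    by (rule comp_minus_left) (use hk x arr_mor[of x] in simp_all)
  ultimately show ?thesis using minus_arr(4)[of "h \<cdot> x" "k \<cdot> x" "Unit C" P] by simp
qed

lemma scalar_multiple_inj:
  assumes "a \<in> carrier K" "b \<in> carrier K" "a \<odot>\<^bsub>Hom C (Unit C) P\<^esub> i = b \<odot>\<^bsub>Hom C (Unit C) P\<^esub> i"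
  shows "a = b"
proof (rule ccontr)
  assume ne: "a \<noteq> b"
  interpret M: module K "Hom C (Unit C) P" using hom_module by simp
  have im: "i \<in> Mor C (Unit C) P" using arr_mor[of i] by simp
  have ab: "a \<ominus>\<^bsub>K\<^esub> b \<in> carrier K" "a \<ominus>\<^bsub>K\<^esub> b \<noteq> \<zero>\<^bsub>K\<^esub>"
    using assms ne scalars.minus_eq_zero_iff by auto
  then have u: "a \<ominus>\<^bsub>K\<^esub> b \<in> Units K" using scalars.field_Units by auto
  have "(a \<ominus>\<^bsub>K\<^esub> b) \<odot>\<^bsub>Hom C (Unit C) P\<^esub> i = zero_mor (Unit C) P"
    using assms im by (simp add: scalars.minus_eq M.smult_l_distr M.smult_l_minus M.r_neg)
  then have "(inv\<^bsub>K\<^esub> (a \<ominus>\<^bsub>K\<^esub> b) \<otimes>\<^bsub>K\<^esub> (a \<ominus>\<^bsub>K\<^esub> b)) \<odot>\<^bsub>Hom C (Unit C) P\<^esub> i = zero_mor (Unit C) P"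
    using M.smult_assoc1[OF scalars.Units_inv_closed[OF u] ab(1) im] u by simp
  then show False using u im hull_nonzero by simp
qed

lemma head_pairing_eq:
  assumes W: "projective C W" and m: "arr m" "src m = W" "tgt m = \<beta>"
    and x: "arr x" "src x = Unit C" "tgt x = W"
  shows "head_pairing m x \<in> carrier K"
    and "lifts_to m h \<Longrightarrow> h \<cdot> x = head_pairing m x \<odot>\<^bsub>Hom C (Unit C) P\<^esub> i"
proof -
  obtain k where k: "lifts_to m k" using lift_exists[OF W m] .
  then have k': "arr k" "src k = W" "tgt k = P" using m unfolding lifts_to_def by auto
  obtain a where a: "a \<in> carrier K" "k \<cdot> x = a \<odot>\<^bsub>Hom C (Unit C) P\<^esub> i"
    by (rule unit_to_hull_scalar[of "k \<cdot> x"]) (use k' x in simp_all)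
  have "head_pairing m x = a" unfolding head_pairing_def
  proof (rule the_equality)
    show "a \<in> carrier K \<and> (\<exists>h. lifts_to m h \<and> h \<cdot> x = a \<odot>\<^bsub>Hom C (Unit C) P\<^esub> i)"
      using a k by blast
    fix b assume "b \<in> carrier K \<and> (\<exists>h. lifts_to m h \<and> h \<cdot> x = b \<odot>\<^bsub>Hom C (Unit C) P\<^esub> i)"
    then show "b = a"
      using lift_comp_unique[OF W _ k m(2) x] a scalar_multiple_inj by metis
  qed
  then show "head_pairing m x \<in> carrier K"
    and "lifts_to m h \<Longrightarrow> h \<cdot> x = head_pairing m x \<odot>\<^bsub>Hom C (Unit C) P\<^esub> i"
    using a lift_comp_unique[OF W _ k m(2) x] by auto
qed

lemma head_pairing_eqI:
  assumes "projective C W" "lifts_to m h" "arr m" "src m = W" "tgt m = \<beta>"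
    and "arr x" "src x = Unit C" "tgt x = W"
    and "a \<in> carrier K" "h \<cdot> x = a \<odot>\<^bsub>Hom C (Unit C) P\<^esub> i"
  shows "head_pairing m x = a"
  using head_pairing_eq[OF assms(1,3-8)] assms(2,9,10) scalar_multiple_inj by metis

lemma head_pairing_linear:
  assumes W: "projective C W" and x: "arr x" "src x = Unit C" "tgt x = W"
  shows "linear_form K (Hom C W \<beta>) (\<lambda>m. head_pairing m x)"
proof -
  have W' [simp]: "W \<in> Obj C" using x by auto
  interpret M: module K "Hom C W \<beta>" using hom_module by simp
  interpret N: module K "Hom C W P" using hom_module by simp
  interpret L: module K "Hom C (Unit C) P" using hom_module by simp
  have im: "i \<in> Mor C (Unit C) P" using arr_mor[of i] by simp
  note pr = linear_mapD[OF comp_linear_right[of W P \<beta> p]]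
  note xr = linear_mapD[OF comp_linear_left[of "Unit C" W P x]]
  have pm: "p \<in> Mor C P \<beta>" and xm: "x \<in> Mor C (Unit C) W" using arr_mor[of p] arr_mor[OF x(1)] x by auto
  have lft: "\<exists>h\<in>Mor C W P. lifts_to m h \<and> h \<cdot> x = head_pairing m x \<odot>\<^bsub>Hom C (Unit C) P\<^esub> i
      \<and> head_pairing m x \<in> carrier K \<and> p \<cdot> h = m"
    if "m \<in> Mor C W \<beta>" for m
  proof -
    have m: "arr m" "src m = W" "tgt m = \<beta>" using that mor_iff by auto
    obtain h where h: "lifts_to m h" using lift_exists[OF W m] .
    then show ?thesis using head_pairing_eq[OF W m x] m
      unfolding lifts_to_def by (intro bexI[of _ h]) (auto simp: mor_iff)
  qed
  have lftI: "head_pairing m x = a" if "m \<in> Mor C W \<beta>" "h \<in> Mor C W P" "p \<cdot> h = m" "a \<in> carrier K"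
    "h \<cdot> x = a \<odot>\<^bsub>Hom C (Unit C) P\<^esub> i" for m h a
    by (rule head_pairing_eqI[OF W, of m h x a])
      (use that mor_iff x in \<open>auto simp: lifts_to_def\<close>)
  show ?thesis unfolding linear_form_def
  proof (intro conjI ballI)
    show "(\<lambda>m. head_pairing m x) \<in> Mor C W \<beta> \<rightarrow> carrier K" using lft by blast
    fix m assume m: "m \<in> Mor C W \<beta>"
    obtain h where h: "h \<in> Mor C W P" "p \<cdot> h = m" "h \<cdot> x = head_pairing m x \<odot>\<^bsub>Hom C (Unit C) P\<^esub> i"
      "head_pairing m x \<in> carrier K"
      using lft[OF m] by blast
    {
      fix n assume n: "n \<in> Mor C W \<beta>"
      obtain k where k: "k \<in> Mor C W P" "p \<cdot> k = n" "k \<cdot> x = head_pairing n x \<odot>\<^bsub>Hom C (Unit C) P\<^esub> i"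
        "head_pairing n x \<in> carrier K"
        using lft[OF n] by blast
      show "head_pairing (m \<oplus>\<^bsub>Hom C W \<beta>\<^esub> n) x = head_pairing m x \<oplus>\<^bsub>K\<^esub> head_pairing n x"
        by (rule lftI[of _ "h \<oplus>\<^bsub>Hom C W P\<^esub> k"])
          (use m n h k pr(2) xr(2) pm xm im in \<open>simp_all add: L.smult_l_distr\<close>)
    next
      fix a assume a: "a \<in> carrier K"
      show "head_pairing (a \<odot>\<^bsub>Hom C W \<beta>\<^esub> m) x = a \<otimes>\<^bsub>K\<^esub> head_pairing m x"
        by (rule lftI[of _ "a \<odot>\<^bsub>Hom C W P\<^esub> h"])
          (use m a h pr(3) xr(3) pm xm im in \<open>simp_all add: L.smult_assoc1\<close>)
    }
  qed
qed

lemma head_pairing_slide: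
  assumes W: "projective C W" "projective C W'"
    and m: "arr m" "src m = W" "tgt m = \<beta>" and g: "arr g" "src g = W'" "tgt g = W"
    and x: "arr x" "src x = Unit C" "tgt x = W'"
  shows "head_pairing (m \<cdot> g) x = head_pairing m (g \<cdot> x)"
proof -
  obtain h where h: "lifts_to m h" using lift_exists[OF W(1) m] .
  then have h': "arr h" "src h = W" "tgt h = P" "p \<cdot> h = m" using m unfolding lifts_to_def by auto
  have "p \<cdot> (h \<cdot> g) = m \<cdot> g" using comp_assoc_arr[of p h g] h' g by (simp del: comp_assoc_arr)
  then have "lifts_to (m \<cdot> g) (h \<cdot> g)" unfolding lifts_to_def using m g h' by simp
  then show ?thesis
    by (rule head_pairing_eqI[OF W(2)])
      (use m g x h' head_pairing_eq[OF W(1) m, of "g \<cdot> x"] h in auto)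
qed

text \<open>As \<open>m\<close> is epic, \<open>p = m e\<close> for some \<open>e : P \<rightarrow> W\<close>. For a lift \<open>h\<close> of \<open>m\<close>, the endomorphism \<open>1 - h e\<close>
  is annihilated by \<open>p\<close>, so it kills \<open>i\<close>; thus \<open>h e i = i\<close> and \<open>e i\<close> is the required \<open>x\<close>.\<close>

lemma head_pairing_nondegenerate_left:
  assumes W: "projective C W" and m: "arr m" "src m = W" "tgt m = \<beta>" and nz: "m \<noteq> zero_mor W \<beta>"
  obtains x where "arr x" "src x = Unit C" "tgt x = W" "head_pairing m x \<noteq> \<zero>\<^bsub>K\<^esub>"
proof -
  have W' [simp]: "W \<in> Obj C" using m by auto
  obtain h where h: "lifts_to m h" using lift_exists[OF W m] .
  then have h' [simp]: "arr h" "src h = W" "tgt h = P" and ph: "p \<cdot> h = m"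
    using m unfolding lifts_to_def by auto
  have "epic C W \<beta> m" using to_simple_epic[OF simple_head m(1,3)] m nz by simp
  then obtain e where e [simp]: "arr e" "src e = P" "tgt e = W" and me: "m \<cdot> e = p"
    by (rule projectiveD[OF P_projective _ head_arr(1-3)])
  have he: "h \<cdot> (e \<cdot> i) \<noteq> zero_mor (Unit C) P"
  proof
    assume z: "h \<cdot> (e \<cdot> i) = zero_mor (Unit C) P"
    let ?d = "Ident C P \<ominus>\<^bsub>Hom C P P\<^esub> h \<cdot> e"
    have mor: "Ident C P \<in> Mor C P P" "h \<cdot> e \<in> Mor C P P" "p \<in> Mor C P \<beta>" "i \<in> Mor C (Unit C) P"
      using mor_iff by auto
    have phe: "p \<cdot> (h \<cdot> e) = p" using comp_assoc_arr[of p h e] ph me by (simp del: comp_assoc_arr)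
    have "p \<cdot> ?d = p \<cdot> Ident C P \<ominus>\<^bsub>Hom C P \<beta>\<^esub> p \<cdot> (h \<cdot> e)"
      by (rule comp_minus_right) (use mor in simp_all)
    then have "p \<cdot> ?d = zero_mor P \<beta>"
      unfolding phe using minus_arr(4)[of p p P \<beta>] by simp
    then have di: "?d \<cdot> i = zero_mor (Unit C) P"
      using minus_arr(1-3)[of "Ident C P" "h \<cdot> e" P P] by (intro hull_endo_kills) simp_all
    have "?d \<cdot> i = Ident C P \<cdot> i \<ominus>\<^bsub>Hom C (Unit C) P\<^esub> (h \<cdot> e) \<cdot> i"
      by (rule comp_minus_left) (use mor in simp_all)
    then have "Ident C P \<cdot> i = (h \<cdot> e) \<cdot> i"
      using di minus_arr(4)[of "Ident C P \<cdot> i" "(h \<cdot> e) \<cdot> i" "Unit C" P] by simp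
    then show False using z hull_nonzero by simp
  qed
  interpret module K "Hom C (Unit C) P" using hom_module by simp
  have "i \<in> Mor C (Unit C) P" using arr_mor[of i] by simp
  then have "head_pairing m (e \<cdot> i) \<noteq> \<zero>\<^bsub>K\<^esub>"
    using head_pairing_eq(2)[OF W m, of "e \<cdot> i"] h he by auto
  then show thesis using that[of "e \<cdot> i"] by simp
qed

text \<open>As \<open>x\<close> is monic and \<open>P\<close> injective, \<open>s x = i\<close> for some \<open>s : W \<rightarrow> P\<close>, which is a lift of \<open>p s\<close>.\<close>

lemma head_pairing_nondegenerate_right:
  assumes W: "projective C W" and x: "arr x" "src x = Unit C" "tgt x = W" and nz: "x \<noteq> zero_mor (Unit C) W"
  obtains m where "arr m" "src m = W" "tgt m = \<beta>" "head_pairing m x \<noteq> \<zero>\<^bsub>K\<^esub>"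
proof -
  have "monic C (Unit C) W x" using from_simple_monic[OF simple_unit, of x] x nz by simp
  then obtain s where s: "arr s" "src s = W" "tgt s = P" "s \<cdot> x = i"
    by (rule injectiveD[OF hull_injective, of _ _ x i]) simp_all
  interpret module K "Hom C (Unit C) P" using hom_module by simp
  have im: "i \<in> Mor C (Unit C) P" using arr_mor[of i] by simp
  have "head_pairing (p \<cdot> s) x = \<one>\<^bsub>K\<^esub>"
    by (rule head_pairing_eqI[OF W, of _ s]) (use s x im in \<open>simp_all add: lifts_to_def\<close>)
  then show thesis using that[of "p \<cdot> s"] s scalars.one_not_zero by simp
qed

section \<open>The twisted trace\<close>

text \<open>The transpose \<open>X U* \<rightarrow> \<beta>\<close> of \<open>g : X \<rightarrow> \<beta> U\<close>.\<close>

definition bend :: "'o \<Rightarrow> 'm \<Rightarrow> 'm"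
  where "bend U g = (Ident C \<beta> \<boxdot> REv C U) \<cdot> (g \<boxdot> Ident C (Dual C U))"

definition twisted_trace :: "'o \<Rightarrow> 'm \<Rightarrow> 'k"
  where "twisted_trace U g = head_pairing (bend U g) (LCoev C U)"

lemma bend_arr [simp]:
  assumes "U \<in> Obj C" "arr g" "tgt g = \<beta> \<boxtimes> U"
  shows "arr (bend U g)" "src (bend U g) = src g \<boxtimes> Dual C U" "tgt (bend U g) = \<beta>"
  using assms unfolding bend_def by auto

text \<open>This identifies the form induced by the trace on \<open>Hom(V, \<beta> U)\<close> and \<open>Hom(U, V)\<close> with the pairing
  for \<open>V U*\<close>, through the transpositions \<open>Hom(V, \<beta> U) \<cong> Hom(V U*, \<beta>)\<close> and
  \<open>Hom(U, V) \<cong> Hom(1, V U*)\<close>.\<close>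

lemma twisted_trace_comp:
  assumes U: "projective C U" and V: "projective C V"
    and f: "arr f" "src f = U" "tgt f = V" and g: "arr g" "src g = V" "tgt g = \<beta> \<boxtimes> U"
  shows "twisted_trace U (g \<cdot> f) = head_pairing (bend U g) ((f \<boxdot> Ident C (Dual C U)) \<cdot> LCoev C U)"
proof -
  have o [simp]: "U \<in> Obj C" "V \<in> Obj C" using f by auto
  have "bend U (g \<cdot> f) = bend U g \<cdot> (f \<boxdot> Ident C (Dual C U))"
    unfolding bend_def using f g by (simp add: whisker_right_comp)
  then show ?thesis unfolding twisted_trace_def
    using head_pairing_slide[OF tensor_right_projective[OF V] tensor_right_projective[OF U],
        of "Dual C U" "Dual C U" "bend U g" "f \<boxdot> Ident C (Dual C U)" "LCoev C U"] f g
    by simp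
qed

lemma twisted_trace_linear:
  assumes U: "projective C U"
  shows "linear_form K (Hom C U (\<beta> \<boxtimes> U)) (twisted_trace U)"
proof -
  have o [simp]: "U \<in> Obj C" using U unfolding projective_def by blast
  have W: "projective C (U \<boxtimes> Dual C U)" by (rule tensor_right_projective[OF U]) simp
  note l = linear_formD[OF head_pairing_linear[OF W, of "LCoev C U", simplified]]
  note t = linear_mapD[OF tensor_linear_left[of U "\<beta> \<boxtimes> U" "Dual C U" "Dual C U" "Ident C (Dual C U)"]]
  note c = linear_mapD[OF comp_linear_right[of "U \<boxtimes> Dual C U" "(\<beta> \<boxtimes> U) \<boxtimes> Dual C U" \<beta> "Ident C \<beta> \<boxdot> REv C U"]]
  have I: "Ident C (Dual C U) \<in> Mor C (Dual C U) (Dual C U)"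
    "Ident C \<beta> \<boxdot> REv C U \<in> Mor C ((\<beta> \<boxtimes> U) \<boxtimes> Dual C U) \<beta>"
    by (auto simp: mor_iff)
  note t = t[OF _ _ _ _ I(1)] and c = c[OF _ _ _ I(2)]
  have b: "linear_map K (Hom C U (\<beta> \<boxtimes> U)) (Hom C (U \<boxtimes> Dual C U) \<beta>) (bend U)"
    unfolding linear_map_def bend_def using t c by auto
  note b' = linear_mapD[OF b]
  show ?thesis unfolding linear_form_def twisted_trace_def using l b' by auto
qed

lemma twisted_trace_nondegenerate_left:
  assumes U: "projective C U" and V: "projective C V"
    and g: "arr g" "src g = V" "tgt g = \<beta> \<boxtimes> U" and nz: "g \<noteq> zero_mor V (\<beta> \<boxtimes> U)"
  obtains f where "arr f" "src f = U" "tgt f = V" "twisted_trace U (g \<cdot> f) \<noteq> \<zero>\<^bsub>K\<^esub>"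
proof -
  have o [simp]: "U \<in> Obj C" "V \<in> Obj C" using U V unfolding projective_def by auto
  have W: "projective C (V \<boxtimes> Dual C U)" by (rule tensor_right_projective[OF V]) simp
  have "bend U g \<noteq> zero_mor (V \<boxtimes> Dual C U) \<beta>"
  proof
    assume z: "bend U g = zero_mor (V \<boxtimes> Dual C U) \<beta>"
    have "(bend U g \<boxdot> Ident C U) \<cdot> (Ident C V \<boxdot> RCoev C U) = g"
      unfolding bend_def by (rule right_transpose_inverse2[OF dual_pair_right[OF o(1)] g]) simp
    then show False unfolding z using nz by simp
  qed
  then obtain x where x: "arr x" "src x = Unit C" "tgt x = V \<boxtimes> Dual C U"
    and ne: "head_pairing (bend U g) x \<noteq> \<zero>\<^bsub>K\<^esub>"
    by (rule head_pairing_nondegenerate_left[OF W, of "bend U g", rotated 3]) (use g in simp_all)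
  obtain f where f: "arr f" "src f = U" "tgt f = V" "(f \<boxdot> Ident C (Dual C U)) \<cdot> LCoev C U = x"
    by (rule coev_right_surj[OF dual_pair_left[OF o(1)] x o(2)])
  then show thesis using that[OF f(1-3)] twisted_trace_comp[OF U V f(1-3) g] ne by simp
qed

lemma twisted_trace_nondegenerate_right:
  assumes U: "projective C U" and V: "projective C V"
    and f: "arr f" "src f = U" "tgt f = V" and nz: "f \<noteq> zero_mor U V"
  obtains g where "arr g" "src g = V" "tgt g = \<beta> \<boxtimes> U" "twisted_trace U (g \<cdot> f) \<noteq> \<zero>\<^bsub>K\<^esub>"
proof -
  have o [simp]: "U \<in> Obj C" "V \<in> Obj C" using U V unfolding projective_def by auto
  have W: "projective C (V \<boxtimes> Dual C U)" by (rule tensor_right_projective[OF V]) simp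
  let ?x = "(f \<boxdot> Ident C (Dual C U)) \<cdot> LCoev C U"
  have "?x \<noteq> zero_mor (Unit C) (V \<boxtimes> Dual C U)"
    using coev_right_inj[OF dual_pair_left[OF o(1)], of f V "zero_mor U V"] f nz by auto
  then obtain m where m: "arr m" "src m = V \<boxtimes> Dual C U" "tgt m = \<beta>"
    and ne: "head_pairing m ?x \<noteq> \<zero>\<^bsub>K\<^esub>"
    by (rule head_pairing_nondegenerate_right[OF W, of ?x, rotated 3]) (use f in simp_all)
  define g where "g = (m \<boxdot> Ident C U) \<cdot> (Ident C V \<boxdot> RCoev C U)"
  have g: "arr g" "src g = V" "tgt g = \<beta> \<boxtimes> U" unfolding g_def using m by simp_all
  have "bend U g = m"
    unfolding bend_def g_def by (rule right_transpose_inverse1[OF dual_pair_right[OF o(1)] m o(2)])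
  then show thesis using that[OF g] twisted_trace_comp[OF U V f g] ne by simp
qed

text \<open>Both sides are values of the pairing for \<open>V U*\<close> at the transpose of \<open>f\<close>: on the left \<open>g\<close> is
  pulled through the evaluation of \<open>V\<close>, on the right through the coevaluation of \<open>U\<close>, and in both
  cases the morphism \<open>g'\<close> of \<open>dual_mate\<close> appears on the other leg.\<close>

lemma twisted_trace_cyclic:
  assumes U: "projective C U" and V: "projective C V"
    and f: "arr f" "src f = V" "tgt f = \<beta> \<boxtimes> U" and g: "arr g" "src g = U" "tgt g = V"
  shows "twisted_trace V ((Ident C \<beta> \<boxdot> g) \<cdot> f) = twisted_trace U (f \<cdot> g)"
proof -
  have o [simp]: "U \<in> Obj C" "V \<in> Obj C" using g by auto
  note f [simp] and g [simp]
  obtain g' where g' [simp]: "arr g'" "src g' = Dual C V" "tgt g' = Dual C U"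
    and co: "(g \<boxdot> Ident C (Dual C U)) \<cdot> LCoev C U = (Ident C V \<boxdot> g') \<cdot> LCoev C V"
    and ev: "REv C V \<cdot> (g \<boxdot> Ident C (Dual C V)) = REv C U \<cdot> (Ident C U \<boxdot> g')"
    by (rule dual_mate[OF g])
  have "bend V ((Ident C \<beta> \<boxdot> g) \<cdot> f)
      = (Ident C \<beta> \<boxdot> (REv C V \<cdot> (g \<boxdot> Ident C (Dual C V)))) \<cdot> (f \<boxdot> Ident C (Dual C V))"
    unfolding bend_def by (simp add: whisker_right_comp whisker_left_comp)
  also have "\<dots> = (Ident C \<beta> \<boxdot> REv C U) \<cdot> ((Ident C (\<beta> \<boxtimes> U) \<boxdot> g') \<cdot> (f \<boxdot> Ident C (Dual C V)))"
    unfolding ev by (simp add: whisker_left_comp)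
  also have "(Ident C (\<beta> \<boxtimes> U) \<boxdot> g') \<cdot> (f \<boxdot> Ident C (Dual C V)) = (f \<boxdot> Ident C (Dual C U)) \<cdot> (Ident C V \<boxdot> g')"
    by (rule slide) simp_all
  also have "(Ident C \<beta> \<boxdot> REv C U) \<cdot> ((f \<boxdot> Ident C (Dual C U)) \<cdot> (Ident C V \<boxdot> g')) = bend U f \<cdot> (Ident C V \<boxdot> g')"
    unfolding bend_def by simp
  finally have b: "bend V ((Ident C \<beta> \<boxdot> g) \<cdot> f) = bend U f \<cdot> (Ident C V \<boxdot> g')" .
  have "twisted_trace V ((Ident C \<beta> \<boxdot> g) \<cdot> f) = head_pairing (bend U f) ((Ident C V \<boxdot> g') \<cdot> LCoev C V)"
    unfolding twisted_trace_def b
    by (rule head_pairing_slide[OF tensor_right_projective[OF V, of "Dual C U"]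
          tensor_right_projective[OF V, of "Dual C V"]]) simp_all
  then show ?thesis unfolding co[symmetric] using twisted_trace_comp[OF U V g f] by simp
qed

lemma proj_endofunctors:
  "endofunctor (Proj C) identity_functor" "endofunctor (Proj C) (left_tensor_functor C \<beta>)"
proof -
  show "endofunctor (Proj C) identity_functor"
    unfolding endofunctor_def identity_functor_def by simp
  show "endofunctor (Proj C) (left_tensor_functor C \<beta>)"
    unfolding endofunctor_def left_tensor_functor_def
    by (auto simp: mor_iff whisker_left_comp projective_obj intro!: tensor_left_projective)
qed

lemma twisted_trace_calabi_yau:
  "twisted_calabi_yau_trace K (Proj C) identity_functor (left_tensor_functor C \<beta>) twisted_trace"
  unfolding twisted_calabi_yau_trace_def identity_functor_def left_tensor_functor_def
    nondegenerate_def
proof (simp, intro conjI allI impI ballI)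
  fix U assume U: "projective C U"
  show "linear_form K (Hom C U (\<beta> \<boxtimes> U)) (twisted_trace U)" by (rule twisted_trace_linear[OF U])
  note [simp] = projective_obj[OF U]
  fix V assume V: "projective C V"
  note [simp] = projective_obj[OF V]
  show "g = zero_mor V (\<beta> \<boxtimes> U)"
    if g: "g \<in> Mor C V (\<beta> \<boxtimes> U)" and z: "\<forall>f\<in>Mor C U V. twisted_trace U (g \<cdot> f) = \<zero>\<^bsub>K\<^esub>" for g
  proof (rule ccontr)
    assume nz: "g \<noteq> zero_mor V (\<beta> \<boxtimes> U)"
    have g': "arr g" "src g = V" "tgt g = \<beta> \<boxtimes> U" using g by (simp_all add: mor_iff)
    show False
      by (rule twisted_trace_nondegenerate_left[OF U V g' nz]) (use z mor_iff in auto)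
  qed
  show "f = zero_mor U V"
    if f: "f \<in> Mor C U V" and z: "\<forall>g\<in>Mor C V (\<beta> \<boxtimes> U). twisted_trace U (g \<cdot> f) = \<zero>\<^bsub>K\<^esub>" for f
  proof (rule ccontr)
    assume nz: "f \<noteq> zero_mor U V"
    have f': "arr f" "src f = U" "tgt f = V" using f by (simp_all add: mor_iff)
    show False
      by (rule twisted_trace_nondegenerate_right[OF U V f' nz]) (use z mor_iff in auto)
  qed
  show "twisted_trace V ((Ident C \<beta> \<boxdot> g) \<cdot> f) = twisted_trace U (f \<cdot> g)"
    if "f \<in> Mor C V (\<beta> \<boxtimes> U)" "g \<in> Mor C U V" for f g
    by (rule twisted_trace_cyclic[OF U V]) (use that in \<open>simp_all add: mor_iff\<close>)
qed

lemma proj_twisted_calabi_yau: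
  "twisted_calabi_yau K (Proj C) identity_functor (left_tensor_functor C \<beta>)"
  unfolding twisted_calabi_yau_def
  using proj_linear_category proj_endofunctors twisted_trace_calabi_yau by blast

end

section \<open>From twisted Calabi-Yau structures to Serre functors\<close>

text \<open>The Serre isomorphism sends \<open>f\<close> to the form \<open>g \<mapsto> t (g f)\<close>. Non-degeneracy makes it injective,
  finite length makes it surjective, and naturality in \<open>U\<close> is cyclicity of the trace.\<close>

lemma calabi_yau_right_serre:
  assumes K: "field K"
    and cy: "twisted_calabi_yau K D identity_functor G"
    and fin: "\<And>X Y. \<lbrakk>X \<in> Obj D; Y \<in> Obj D\<rbrakk> \<Longrightarrow> finite_length_module K (Hom D X Y)"
  shows "right_serre_functor K D G"
proof -
  interpret K: field K by fact
  interpret D: linear_category K D using cy unfolding twisted_calabi_yau_def by blast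
  let ?G = "OnObj G"
  obtain t where t: "twisted_calabi_yau_trace K D identity_functor G t"
    and G: "endofunctor D G"
    using cy unfolding twisted_calabi_yau_def by blast
  have tl: "linear_form K (Hom D U (?G U)) (t U)" if "U \<in> Obj D" for U
    using t that unfolding twisted_calabi_yau_trace_def identity_functor_def by simp
  have nd: "nondegenerate K (Hom D V (?G U)) (Hom D U V) (\<lambda>g f. t U (g \<cdot>\<^bsub>D\<^esub> f))"
    if "U \<in> Obj D" "V \<in> Obj D" for U V
    using t that unfolding twisted_calabi_yau_trace_def identity_functor_def by simp
  have cyc: "t V (OnMor G g \<cdot>\<^bsub>D\<^esub> f) = t U (f \<cdot>\<^bsub>D\<^esub> g)"
    if "U \<in> Obj D" "V \<in> Obj D" "f \<in> Mor D V (?G U)" "g \<in> Mor D U V" for U V f g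
    using t that unfolding twisted_calabi_yau_trace_def identity_functor_def by simp
  have GO: "?G U \<in> Obj D" if "U \<in> Obj D" for U using G that unfolding endofunctor_def by blast
  have GM: "OnMor G f \<in> Mor D (?G X) (?G Y)" if "X \<in> Obj D" "Y \<in> Obj D" "f \<in> Mor D X Y" for X Y f
    using G that unfolding endofunctor_def by blast
  note comp = D.comp_in_hom
  have cr: "linear_form K (Hom D U V) (\<lambda>f. t U (g \<cdot>\<^bsub>D\<^esub> f))"
    if o: "U \<in> Obj D" "V \<in> Obj D" and g: "g \<in> Mor D V (?G U)" for U V g
    using linear_formD[OF tl[OF o(1)]] linear_mapD[OF D.comp_linear_right[OF o GO[OF o(1)] g]]
    unfolding linear_form_def by auto
  have cl: "linear_form K (Hom D V (?G U)) (\<lambda>g. t U (g \<cdot>\<^bsub>D\<^esub> f))"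
    if o: "U \<in> Obj D" "V \<in> Obj D" and f: "f \<in> Mor D U V" for U V f
    using linear_formD[OF tl[OF o(1)]] linear_mapD[OF D.comp_linear_left[OF o GO[OF o(1)] f]]
    unfolding linear_form_def by auto
  define \<eta> where "\<eta> U V f = (\<lambda>g\<in>Mor D V (?G U). t U (g \<cdot>\<^bsub>D\<^esub> f))" for U V f
  have iso: "linear_iso K (Hom D U V) (dual_module K (Hom D V (?G U))) (\<eta> U V)"
    if o [simp]: "U \<in> Obj D" "V \<in> Obj D" for U V
  proof -
    note GU [simp] = GO[OF o(1)]
    interpret M: module K "Hom D U V" by (rule D.hom_module) simp_all
    interpret N: module K "Hom D V (?G U)" by (rule D.hom_module) simp_all
    note r = linear_formD[OF cr[OF o]] and l = linear_formD[OF cl[OF o]]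
    have \<eta>form: "linear_form K (Hom D V (?G U)) (\<eta> U V f)" if "f \<in> Mor D U V" for f
      using l[OF that] unfolding linear_form_def \<eta>_def by auto
    have lin: "linear_map K (Hom D U V) (dual_module K (Hom D V (?G U))) (\<eta> U V)"
      unfolding linear_map_def
    proof (intro conjI ballI)
      show "\<eta> U V \<in> Mor D U V \<rightarrow> carrier (dual_module K (Hom D V (?G U)))"
        using \<eta>form by (auto simp: dual_module_def \<eta>_def)
    qed (use r in \<open>auto simp: dual_module_def \<eta>_def intro!: restrict_ext\<close>)
    moreover have "inj_on (\<eta> U V) (Mor D U V)"
    proof (rule inj_onI)
      fix f f' assume f: "f \<in> Mor D U V" "f' \<in> Mor D U V" and e: "\<eta> U V f = \<eta> U V f'"
      let ?d = "f \<ominus>\<^bsub>Hom D U V\<^esub> f'"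
      have d: "?d \<in> Mor D U V" using f by simp
      have "t U (g \<cdot>\<^bsub>D\<^esub> ?d) = \<zero>\<^bsub>K\<^esub>" if g: "g \<in> Mor D V (?G U)" for g
      proof -
        have "t U (g \<cdot>\<^bsub>D\<^esub> f) = t U (g \<cdot>\<^bsub>D\<^esub> f')"
          using fun_cong[OF e, of g] g by (simp add: \<eta>_def)
        then show ?thesis
          using linear_form_minus[OF M.module_axioms cr[OF o g] f] r(2)[OF g f(2)]
          by (simp add: K.minus_eq K.r_neg)
      qed
      then have "?d = \<zero>\<^bsub>Hom D U V\<^esub>"
        using nd[OF o] d unfolding nondegenerate_def by blast
      then show "f = f'" using M.minus_eq_zero_iff f by simp
    qed
    moreover have "\<eta> U V ` Mor D U V = carrier (dual_module K (Hom D V (?G U)))"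
    proof
      show "\<eta> U V ` Mor D U V \<subseteq> carrier (dual_module K (Hom D V (?G U)))"
        using linear_mapD(1)[OF lin] by blast
      show "carrier (dual_module K (Hom D V (?G U))) \<subseteq> \<eta> U V ` Mor D U V"
      proof
        fix \<phi> assume "\<phi> \<in> carrier (dual_module K (Hom D V (?G U)))"
        then have \<phi>: "\<phi> \<in> extensional (Mor D V (?G U))" "linear_form K (Hom D V (?G U)) \<phi>"
          by (auto simp: dual_module_def)
        have "\<exists>f\<in>Mor D U V. \<forall>g\<in>Mor D V (?G U). t U (g \<cdot>\<^bsub>D\<^esub> f) = \<phi> g"
          by (rule nondegenerate_represents_form[OF K M.module_axioms N.module_axioms])
            (use fin nd[OF o] cr cl \<phi> in \<open>auto simp: nondegenerate_def\<close>)
        then obtain f where f: "f \<in> Mor D U V" "\<And>g. g \<in> Mor D V (?G U) \<Longrightarrow> t U (g \<cdot>\<^bsub>D\<^esub> f) = \<phi> g"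
          by blast
        have "\<eta> U V f = \<phi>"
          by (rule extensionalityI[OF _ \<phi>(1)]) (use f in \<open>auto simp: \<eta>_def\<close>)
        then show "\<phi> \<in> \<eta> U V ` Mor D U V" using f(1) by blast
      qed
    qed
    ultimately show ?thesis unfolding linear_iso_def bij_betw_def by simp
  qed
  have nat1: "\<eta> U' V (f \<cdot>\<^bsub>D\<^esub> h) g = \<eta> U V f (OnMor G h \<cdot>\<^bsub>D\<^esub> g)"
    if o: "U \<in> Obj D" "U' \<in> Obj D" "V \<in> Obj D"
      and m: "h \<in> Mor D U' U" "f \<in> Mor D U V" "g \<in> Mor D V (?G U')" for U U' V f g h
  proof -
    note GU = GO[OF o(1)] GO[OF o(2)]
    have "t U (OnMor G h \<cdot>\<^bsub>D\<^esub> (g \<cdot>\<^bsub>D\<^esub> f)) = t U' ((g \<cdot>\<^bsub>D\<^esub> f) \<cdot>\<^bsub>D\<^esub> h)"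
      by (rule cyc[OF o(2,1)]) (use comp[OF o(1,3) GU(2) m(3,2)] m in auto)
    moreover have "OnMor G h \<cdot>\<^bsub>D\<^esub> g \<in> Mor D V (?G U)"
      by (rule comp[OF o(3) GU(2,1) GM[OF o(2,1) m(1)] m(3)])
    ultimately show ?thesis
      using m D.comp_assoc[OF o(1,3) GU(2,1) GM[OF o(2,1) m(1)] m(3,2)]
        D.comp_assoc[OF o(2,1,3) GU(2) m(3,2,1)]
      by (simp add: \<eta>_def)
  qed
  have nat2: "\<eta> U V' (h \<cdot>\<^bsub>D\<^esub> f) g = \<eta> U V f (g \<cdot>\<^bsub>D\<^esub> h)"
    if o: "U \<in> Obj D" "V \<in> Obj D" "V' \<in> Obj D"
      and m: "h \<in> Mor D V V'" "f \<in> Mor D U V" "g \<in> Mor D V' (?G U)" for U V V' f g h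
    using D.comp_assoc[OF o GO[OF o(1)] m(3,1,2)] comp[OF o(2,3) GO[OF o(1)] m(3,1)] m(3)
    by (simp add: \<eta>_def)
  show ?thesis
    unfolding right_serre_functor_def
    using D.linear_category_axioms G iso nat1 nat2
    by (intro conjI exI[of _ \<eta>] ballI) auto
qed

section \<open>Projective objects form a twisted Calabi-Yau category\<close>

theorem mainTheorem6:
  fixes K :: "('k, 'r) ring_scheme"
    and C :: "('k, 'o, 'm, 'z) pivotal_cat_scheme"
    and P \<beta> :: 'o and i :: 'm
  assumes "algebraically_closed K"
    and "pivotal_tensor_category K C"
    and "abelian_category K C"
    and "locally_finite K C"
    and "enough_projectives C"
    and "injective_hull C (Unit C) P i"
    and "is_head C P \<beta>"
  shows "twisted_calabi_yau K (Proj C) identity_functor (left_tensor_functor C \<beta>) \<and>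
    right_serre_functor K (Proj C) (left_tensor_functor C \<beta>)"
proof -
  have K: "field K" using assms(1) by (rule algebraically_closed.axioms(1))
  interpret pivotal_abelian_category K C
    by (intro pivotal_abelian_category.intro assms(2,3) K)
  have "finite_length_object C (Unit C)"
    using assms(4) unfolding locally_finite_def by simp
  then interpret unit_hull K C P i
    by unfold_locales (use assms(6) unit_simple in auto)
  obtain p where "simple_object C \<beta>" "epic C P \<beta> p"
    using assms(7) unfolding is_head_def by blast
  then interpret unit_hull_head K C P i \<beta> p
    by unfold_locales (use hull_projective[OF assms(5)] in auto)
  have "finite_length_module K (Hom (Proj C) X Y)" if "X \<in> Obj (Proj C)" "Y \<in> Obj (Proj C)" for X Y
    using assms(4) that projective_obj unfolding locally_finite_def by simp
  then show ?thesis
    using proj_twisted_calabi_yau calabi_yau_right_serre[OF K proj_twisted_calabi_yau] by blast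
qed

end
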